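(* Let $x\ge 2$ be a real number. Define $\delta=\delta(x)$ by $$\sum_{p\le x}\frac1p=\ln\ln [x]+\gamma+\sum_{m=2}^{\infty}\mu(m)\,\frac{\ln \zeta(m)}{m}+\delta .$$ Then $$|\delta|<\frac{4}{\ln([x]+1)}+\frac{2}{[x]\ln [x]} .$$
   Context: The sum $\sum_{p\le x}$ runs over primes $p\le x$; $[x]$ is the greatest integer not exceeding $x$; $\ln$ is the natural logarithm; $\gamma$ is Euler's constant; $\mu$ is the Möbius function; $\zeta$ is the Riemann zeta function. *)

theory Defs
  imports
    "HOL-Analysis.Analysis"
    "HOL-Computational_Algebra.Primes"
    "HOL-Computational_Algebra.Squarefree"
begin

definition moebius_mu :: "nat \<Rightarrow> int" where
  "moebius_mu n = (if squarefree n then (- 1) ^ card (prime_factors n) else 0)"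

(* The Riemann zeta function on the half-line s > 1, where it is given by its Dirichlet series;
   no meaning is intended for s \<le> 1. *)
definition riemann_zeta :: "real \<Rightarrow> real" where
  "riemann_zeta s = (\<Sum>n. 1 / real (Suc n) powr s)"

end

theory Submission
  imports Defs "HOL-Real_Asymp.Real_Asymp"
begin

text \<open>
  Put \<open>n = \<lfloor>x\<rfloor>\<close> and \<open>E k = (\<Sum>p\<le>k. ln p / p) - ln k\<close>. Mertens' first theorem says that \<open>E\<close> is
  bounded, and partial summation with the weights \<open>1 / ln k\<close> turns a two-sided bound
  \<open>a \<le> E k \<le> b\<close> into the convergence of \<open>(\<Sum>p\<le>n. 1/p) - ln (ln n)\<close> to some constant \<open>B\<close>, with
  remainder \<open>E n / ln n - \<rho> / ln n\<close>, where \<open>\<rho>\<close> is a weighted mean of later values of the error and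
  therefore also lies in \<open>[a, b]\<close>. The two terms partly compensate: the remainder is at most
  \<open>(b - a) / ln n\<close>, whatever the position of the interval. Comparing
  \<open>ln (n!)\<close> with \<open>n * ln n\<close> and using \<open>\<Sum>p\<le>n. ln p \<le> n * ln 4\<close> gives \<open>b = ln 4\<close>
  and \<open>a = - 1 - ln 4\<close> (\<open>mertens_err_upper\<close>, \<open>mertens_err_lower\<close>), hence \<open>b - a < 3.78\<close>. Since
  \<open>4 * ln n / ln (n + 1) + 2 / n\<close> exceeds this for \<open>n \<ge> 3\<close>, the bound follows there; for
  \<open>n = 2\<close> the exact value \<open>E 2 = - ln 2 / 2\<close> is used (\<open>mertens_diff_error\<close>).

  The other half is the value of \<open>B\<close>. The function
  \<open>D u = (\<Sum>p\<le>exp u. 1/p) - (\<Sum>k\<le>u. 1/k)\<close> tends to \<open>B - \<gamma>\<close>, because both sums are \<open>ln u\<close> plus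
  a constant in the limit. By Abel's theorem for the Laplace transform, so does
  \<open>s * (\<integral>u. exp (- s * u) * D u)\<close> as \<open>s\<close> decreases to \<open>0\<close>; but this integral is
  \<open>(\<Sum>p. p powr - (1 + s)) + ln (1 - exp (- s))\<close> (\<open>prime_zeta_abel_limit\<close>).
  The simple pole of zeta gives \<open>ln (\<zeta> (1 + s)) + ln (1 - exp (- s)) \<longlonglongrightarrow> 0\<close>, and the Euler product shows
  that \<open>ln (\<zeta> (1 + s))\<close> differs from the sum over primes by an amount tending to
  \<open>- (\<Sum>p. 1/p + ln (1 - 1/p))\<close>. Hence \<open>B = \<gamma> + (\<Sum>p. 1/p + ln (1 - 1/p))\<close> (\<open>mertens_const_eq\<close>).
  Finally, expanding \<open>ln (\<zeta> m)\<close> by the Euler product and summing over \<open>m\<close> first, Moebius inversion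
  identifies that sum over primes with \<open>\<Sum>m\<ge>2. \<mu> m * ln (\<zeta> m) / m\<close>
  (\<open>sums_moebius_ln_riemann_zeta\<close>).
\<close>

section \<open>Chebyshev's bound for the product of the primes\<close>

lemma prod_distinct_primes_dvd:
  fixes N :: nat
  assumes "finite A" "\<And>p. p \<in> A \<Longrightarrow> prime p" "\<And>p. p \<in> A \<Longrightarrow> p dvd N"
  shows "\<Prod>A dvd N"
  using assms
proof (induction A rule: finite_induct)
  case (insert p A)
  have "coprime p (\<Prod>A)"
    by (rule prod_coprime_right) (metis insert.hyps(2) insert.prems(1) insertCI primes_coprime)
  with insert show ?case
    by (simp add: divides_mult)
qed simp

lemma choose_odd_le_4_pow: "(2 * m + 1) choose m \<le> 4 ^ m"
proof -
  have "2 * ((2 * m + 1) choose m) = (\<Sum>k\<in>{m, m + 1}. (2 * m + 1) choose k)"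
    using binomial_symmetric[of m "2 * m + 1"] by simp
  also have "\<dots> \<le> (\<Sum>k\<le>2 * m + 1. (2 * m + 1) choose k)"
    by (rule sum_mono2) auto
  also have "\<dots> = 2 * 4 ^ m"
    by (simp only: choose_row_sum) (simp add: power_mult)
  finally show ?thesis by simp
qed

text \<open>Erdos's induction. Even numbers above 2 add no prime, and for \<open>n = 2 * m + 1\<close> the primes in
  \<open>(m + 1, n]\<close> all divide \<open>n choose m\<close>, which is at most \<open>4 ^ m\<close>; the primes up to \<open>m + 1\<close> are
  covered by the induction hypothesis.\<close>
lemma primorial_le_4_pow: "\<Prod>{p::nat. prime p \<and> p \<le> n} \<le> 4 ^ n"
proof (induction n rule: less_induct)
  case (less n)
  consider "n \<le> 1" | "n = 2" | "n > 2" "even n" | m where "n = 2 * m + 1" "m \<ge> 1"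
  proof (cases "even n")
    case True
    then show ?thesis using that(1-3) by linarith
  next
    case False
    then obtain m where m: "n = 2 * m + 1" by (rule oddE)
    then show ?thesis using that(1) that(4)[of m] by (cases "m = 0") auto
  qed
  then show ?case
  proof cases
    case 1
    have "\<not> (prime p \<and> p \<le> n)" for p :: nat
      using 1 prime_ge_2_nat[of p] by linarith
    then have e: "{p. prime p \<and> p \<le> n} = {}" by simp
    show ?thesis unfolding e by simp
  next
    case 2
    have "{p::nat. prime p \<and> p \<le> 2} = {2}"
      using prime_ge_2_nat two_is_prime_nat le_antisym by blast
    then show ?thesis using 2 by simp
  next
    case 3
    have "prime p \<and> p \<le> n \<longleftrightarrow> prime p \<and> p \<le> n - 1" for p
    proof -
      have "\<not> prime n" using 3 prime_odd_nat[of n] by blast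
      then show ?thesis using 3 by (cases "p = n") auto
    qed
    then have "{p. prime p \<and> p \<le> n} = {p. prime p \<and> p \<le> n - 1}"
      by presburger
    then have "\<Prod>{p. prime p \<and> p \<le> n} \<le> 4 ^ (n - 1)"
      using less.IH[of "n - 1"] 3 by simp
    also have "\<dots> \<le> 4 ^ n" by (intro power_increasing) auto
    finally show ?thesis .
  next
    case (4 m)
    let ?A = "{p. prime p \<and> p \<le> m + 1}" and ?B = "{p. prime p \<and> m + 1 < p \<and> p \<le> n}"
    have "\<Prod>?B dvd n choose m"
    proof (rule prod_distinct_primes_dvd)
      fix p assume p: "p \<in> ?B"
      have "p dvd fact n"
        using p by (auto simp: prime_dvd_fact_iff)
      also have "fact n = fact m * fact (m + 1) * (n choose m)"
        using binomial_fact_lemma[of m n] 4 by simp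
      finally show "p dvd n choose m"
        using p by (auto simp: prime_dvd_mult_iff prime_dvd_fact_iff simp del: fact_Suc)
    qed auto
    then have "\<Prod>?B \<le> n choose m"
      using 4 by (intro dvd_imp_le) auto
    also have "\<dots> \<le> 4 ^ m"
      using choose_odd_le_4_pow[of m] 4 by simp
    finally have B: "\<Prod>?B \<le> 4 ^ m" .
    have "{p. prime p \<and> p \<le> n} = ?A \<union> ?B" using 4 by auto
    then have "\<Prod>{p. prime p \<and> p \<le> n} = \<Prod>?A * \<Prod>?B"
      by (simp, subst prod.union_disjoint) auto
    also have "\<dots> \<le> 4 ^ (m + 1) * 4 ^ m"
      using 4 by (intro mult_mono B less.IH) auto
    also have "\<dots> = 4 ^ n" using 4 by (simp flip: power_add add: mult_2)
    finally show ?thesis .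
  qed
qed

lemma chebyshev_theta_le: "(\<Sum>p | prime p \<and> p \<le> n. ln (real p)) \<le> real n * ln 4"
proof -
  have "(\<Sum>p | prime p \<and> p \<le> n. ln (real p)) = ln (real (\<Prod>{p. prime p \<and> p \<le> n}))"
    by (simp, subst ln_prod) (auto simp: prime_gt_0_nat)
  also have "\<dots> \<le> ln (real (4 ^ n))"
  proof (rule ln_mono)
    show "0 < real (\<Prod>{p. prime p \<and> p \<le> n})"
      by (auto simp: prime_gt_0_nat intro!: prod_pos)
    show "real (\<Prod>{p. prime p \<and> p \<le> n}) \<le> real (4 ^ n)"
      using primorial_le_4_pow[of n] of_nat_le_iff by blast
  qed
  also have "\<dots> = real n * ln 4" by (simp add: ln_realpow)
  finally show ?thesis .
qed

section \<open>The factorial and its prime factors\<close>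

text \<open>One step of Legendre's formula: the multiples of \<open>p\<close> up to \<open>n\<close> are \<open>p * j\<close> with
  \<open>j \<le> n div p\<close>, and each contributes one factor \<open>p\<close> besides those of \<open>j\<close>. This form gives both
  bounds on the multiplicity that are needed, without an infinite sum over powers of \<open>p\<close>.\<close>
lemma multiplicity_fact:
  fixes p :: nat
  assumes "prime p"
  shows "multiplicity p (fact n :: nat) = n div p + multiplicity p (fact (n div p) :: nat)"
proof (induction n)
  case (Suc n)
  have p: "prime_elem p" "p > 1" using assms prime_gt_1_nat[OF assms] by auto
  have split: "multiplicity p (fact (Suc j) :: nat) = multiplicity p (Suc j) + multiplicity p (fact j :: nat)" for j
    unfolding fact_Suc of_nat_id
    by (rule prime_elem_multiplicity_mult_distrib) (use p in auto)
  show ?case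
  proof (cases "p dvd Suc n")
    case False
    then have "multiplicity p (Suc n) = 0" "Suc n div p = n div p"
      by (auto simp: not_dvd_imp_multiplicity_0 div_Suc dvd_eq_mod_eq_0)
    then show ?thesis using Suc split by simp
  next
    case True
    then obtain k where k: "Suc n = p * k" by auto
    then obtain j where j: "k = Suc j" by (cases k) auto
    have "Suc n div p = Suc j" using k j p by simp
    moreover have "n div p = j"
      using True calculation by (simp add: div_Suc dvd_eq_mod_eq_0)
    moreover have "multiplicity p (Suc n) = 1 + multiplicity p (Suc j)"
      using p by (simp add: k j prime_elem_multiplicity_mult_distrib del: mult_Suc_right)
    ultimately show ?thesis using Suc split by simp
  qed
qed simp

lemma multiplicity_fact_upper:
  fixes p :: nat
  assumes "prime p"
  shows "(p - 1) * multiplicity p (fact n :: nat) \<le> n"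
proof (induction n rule: less_induct)
  case (less n)
  show ?case
  proof (cases "n = 0")
    case False
    let ?q = "n div p"
    have p: "p > 1" using assms by (rule prime_gt_1_nat)
    have "(p - 1) * multiplicity p (fact n :: nat) = (p - 1) * ?q + (p - 1) * multiplicity p (fact ?q :: nat)"
      by (subst multiplicity_fact[OF assms]) (simp add: distrib_left)
    also have "\<dots> \<le> (p - 1) * ?q + ?q"
      using less.IH[of ?q] False p by simp
    also have "\<dots> = p * ?q" using p by (simp add: algebra_simps)
    also have "\<dots> \<le> n" by simp
    finally show ?thesis .
  qed simp
qed

lemma ln_fact_eq_sum_primes:
  "ln (fact n :: real) = (\<Sum>p | prime p \<and> p \<le> n. real (multiplicity p (fact n :: nat)) * ln (real p))"
proof -
  have pf: "prime_factors (fact n :: nat) = {p. prime p \<and> p \<le> n}"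
    by (auto simp: prime_factors_dvd prime_dvd_fact_iff)
  have "(fact n :: real) = real (\<Prod>p\<in>prime_factors (fact n). p ^ multiplicity p (fact n))"
    by (subst prime_factorization_nat[symmetric]) auto
  also have "ln \<dots> = (\<Sum>p | prime p \<and> p \<le> n. ln (real p ^ multiplicity p (fact n :: nat)))"
    unfolding pf of_nat_prod of_nat_power by (subst ln_prod) (auto simp: prime_gt_0_nat)
  also have "\<dots> = (\<Sum>p | prime p \<and> p \<le> n. real (multiplicity p (fact n :: nat)) * ln (real p))"
    by (intro sum.cong refl ln_realpow)
  finally show ?thesis .
qed

lemma ln_Suc_minus_ln_le: "n > 0 \<Longrightarrow> ln (real (Suc n)) - ln (real n) \<le> 1 / real n"
  using ln_diff_le[of "real (Suc n)" "real n"] by simp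

lemma ln_fact_lower: "n > 0 \<Longrightarrow> ln (fact n :: real) \<ge> real n * ln (real n) - real n + 1"
proof (induction n rule: nat_induct_non_zero)
  case (Suc n)
  have "real n * (ln (real (Suc n)) - ln (real n)) \<le> real n * (1 / real n)"
    by (intro mult_left_mono ln_Suc_minus_ln_le) (use Suc in auto)
  then have *: "real n * ln (real (Suc n)) \<le> real n * ln (real n) + 1"
    using Suc by (simp add: algebra_simps)
  have "ln (fact (Suc n) :: real) = ln (real (Suc n)) + ln (fact n)"
    unfolding fact_Suc by (subst ln_mult) auto
  moreover have "real (Suc n) * ln (real (Suc n)) = real n * ln (real (Suc n)) + ln (real (Suc n))"
    by (simp add: algebra_simps)
  moreover have "real (Suc n) = real n + 1" by simp
  ultimately show ?case using Suc * by linarith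
qed simp

lemma ln_fact_upper: "n > 0 \<Longrightarrow> ln (fact n :: real) \<le> real n * ln (real n)"
proof -
  assume n: "n > 0"
  have "(fact n :: real) \<le> real (n ^ n)" by (metis fact_le_power order_refl)
  then have "ln (fact n :: real) \<le> ln (real n ^ n)" using n by simp
  also have "\<dots> = real n * ln (real n)" using n by (simp add: ln_realpow)
  finally show ?thesis .
qed

lemma ln_4_eq: "ln (4::real) = 2 * ln 2"
  using ln_realpow[of 2 2] by simp

lemma ln_4_ge: "ln (4::real) \<ge> 5 / 4"
  using ln2_ge_two_thirds by (simp add: ln_4_eq)

section \<open>Mertens' first theorem with explicit constants\<close>

text \<open>The left side is \<open>ln 4\<close> at \<open>m = 2\<close> and decreases towards 1; for \<open>m \<ge> 3\<close> the trapezoidal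
  bound for \<open>\<integral>dt/t\<close> already gives \<open>5 / 4\<close>.\<close>
lemma mult_ln_ratio_le_ln_4:
  assumes "m \<ge> 2"
  shows "real m * (ln (real m) - ln (real m - 1)) \<le> ln 4"
proof (cases "m = 2")
  case True
  then show ?thesis by (simp add: ln_4_eq)
next
  case False
  then have m: "m \<ge> 3" using assms by simp
  have "ln (real m - 1 + 1) - ln (real m - 1) \<le> 1 * (inverse (real m - 1) + inverse (real m - 1 + 1)) / 2"
    by (rule ln_inverse_approx_le) (use m in auto)
  then have "real m * (ln (real m) - ln (real m - 1)) \<le> real m * ((inverse (real m - 1) + inverse (real m)) / 2)"
    by (intro mult_left_mono) auto
  also have "\<dots> = 1 + 1 / (2 * (real m - 1))"
    using m by (simp add: field_simps)
  also have "\<dots> \<le> 5 / 4"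
    using m by (simp add: field_simps)
  also have "\<dots> \<le> ln 4" by (rule ln_4_ge)
  finally show ?thesis .
qed

text \<open>The right side is found by telescoping: \<open>g m = (ln m + ln 4) / m\<close> satisfies
  \<open>g (m - 1) - g m \<ge> ln m / (m * (m - 1))\<close> exactly when
  \<open>m * (ln m - ln (m - 1)) \<le> ln 4\<close>, and \<open>g 1 = ln 4\<close>. The sum controls the prime powers
  \<open>p ^ k\<close> with \<open>k \<ge> 2\<close> that contribute to \<open>ln (n!)\<close>.\<close>
lemma sum_ln_over_pronic_le:
  "n \<ge> 1 \<Longrightarrow> (\<Sum>m=2..n. ln (real m) / (real m * (real m - 1))) \<le> ln 4 - (ln (real n) + ln 4) / real n"
proof (induction n rule: nat_induct_at_least)
  case (Suc n)
  have n: "real n > 0" using Suc by simp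
  have "(\<Sum>m=2..Suc n. ln (real m) / (real m * (real m - 1)))
      = (\<Sum>m=2..n. ln (real m) / (real m * (real m - 1))) + ln (real (Suc n)) / (real (Suc n) * real n)"
    using Suc.hyps by (subst sum.cl_ivl_Suc) auto
  also have "\<dots> \<le> ln 4 - (ln (real n) + ln 4) / real n + ln (real (Suc n)) / (real (Suc n) * real n)"
    using Suc.IH by simp
  also have "\<dots> \<le> ln 4 - (ln (real (Suc n)) + ln 4) / real (Suc n)"
  proof -
    have "real (Suc n) * (ln (real (Suc n)) - ln (real n)) \<le> ln 4"
      using mult_ln_ratio_le_ln_4[of "Suc n"] Suc by simp
    then have "(real (Suc n) * (ln (real (Suc n)) - ln (real n)) - ln 4) / (real (Suc n) * real n) \<le> 0"
      using n by (simp add: divide_le_0_iff)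
    also have "(real (Suc n) * (ln (real (Suc n)) - ln (real n)) - ln 4) / (real (Suc n) * real n) =
      ln (real (Suc n)) / (real (Suc n) * real n) - (ln (real n) + ln 4) / real n + (ln (real (Suc n)) + ln 4) / real (Suc n)"
      using n by (simp add: divide_simps) (simp add: algebra_simps)
    finally show ?thesis by simp
  qed
  finally show ?case .
qed simp

definition mertens_err :: "nat \<Rightarrow> real" where
  "mertens_err n = (\<Sum>p | prime p \<and> p \<le> n. ln (real p) / real p) - ln (real n)"

text \<open>The multiplicity of \<open>p\<close> in \<open>n!\<close> is at least \<open>n / p - 1\<close>. Summing against \<open>ln p\<close> compares
  \<open>n * (\<Sum>p\<le>n. ln p / p)\<close> with \<open>ln (n!) \<le> n * ln n\<close>, at the cost of \<open>\<Sum>p\<le>n. ln p\<close>.\<close>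
lemma mertens_err_upper: assumes "n > 0" shows "mertens_err n \<le> ln 4"
proof -
  have "real n * (\<Sum>p | prime p \<and> p \<le> n. ln (real p) / real p) - (\<Sum>p | prime p \<and> p \<le> n. ln (real p))
      = (\<Sum>p | prime p \<and> p \<le> n. (real n / real p - 1) * ln (real p))"
    by (simp add: sum_distrib_left algebra_simps flip: sum_subtractf)
  also have "\<dots> \<le> (\<Sum>p | prime p \<and> p \<le> n. real (multiplicity p (fact n :: nat)) * ln (real p))"
  proof (intro sum_mono mult_right_mono)
    fix p assume p: "p \<in> {p. prime p \<and> p \<le> n}"
    have "p > 0" using p prime_gt_0_nat by blast
    moreover from this have "n \<le> p * (n div p) + p"
      using mod_less_divisor[of p n] mult_div_mod_eq[of p n] by linarith
    then have "real n \<le> real (p * (n div p) + p)" by (simp only: of_nat_le_iff)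
    then have "real n \<le> real p * real (n div p) + real p" by simp
    ultimately have "real n \<le> real p * real (n div p) + real p" "p > 0" by auto
    then have "real n / real p - 1 \<le> real (n div p)"
      by (simp add: field_simps)
    also have "\<dots> \<le> real (multiplicity p (fact n :: nat))"
      using p multiplicity_fact[of p n] by simp
    finally show "real n / real p - 1 \<le> real (multiplicity p (fact n :: nat))" .
    show "0 \<le> ln (real p)" using p by (auto intro!: ln_ge_zero dest: prime_ge_1_nat)
  qed
  also have "\<dots> = ln (fact n)" by (rule ln_fact_eq_sum_primes[symmetric])
  also have "\<dots> \<le> real n * ln (real n)" by (rule ln_fact_upper[OF assms])
  finally have "real n * mertens_err n \<le> real n * ln 4"
    using chebyshev_theta_le[of n] by (simp add: mertens_err_def algebra_simps)
  then show ?thesis using assms by simp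
qed

text \<open>Dually, the multiplicity of \<open>p\<close> in \<open>n!\<close> is at most \<open>n / (p - 1)\<close>. The extra \<open>1 / n\<close> is what
  lets the bound survive the passage from \<open>ln n\<close> to \<open>ln (n + 1)\<close> in the partial summation.\<close>
lemma mertens_err_lower: assumes "n > 0" shows "mertens_err n \<ge> - 1 - ln 4 + 1 / real n"
proof -
  have "real n * ln (real n) - real n + 1 \<le> ln (fact n)" by (rule ln_fact_lower[OF assms])
  also have "\<dots> = (\<Sum>p | prime p \<and> p \<le> n. real (multiplicity p (fact n :: nat)) * ln (real p))"
    by (rule ln_fact_eq_sum_primes)
  also have "\<dots> \<le> (\<Sum>p | prime p \<and> p \<le> n. (real n / (real p - 1)) * ln (real p))"
  proof (intro sum_mono mult_right_mono)
    fix p assume p: "p \<in> {p. prime p \<and> p \<le> n}"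
    then have p1: "p > 1" using prime_gt_1_nat by blast
    have "real ((p - 1) * multiplicity p (fact n :: nat)) \<le> real n"
      using p multiplicity_fact_upper[of p n] by (simp only: of_nat_le_iff mem_Collect_eq)
    then show "real (multiplicity p (fact n :: nat)) \<le> real n / (real p - 1)"
      using p1 by (simp add: field_simps of_nat_diff)
    show "0 \<le> ln (real p)" using p1 by simp
  qed
  also have "\<dots> = real n * ((\<Sum>p | prime p \<and> p \<le> n. ln (real p) / real p)
                  + (\<Sum>p | prime p \<and> p \<le> n. ln (real p) / (real p * (real p - 1))))"
    unfolding sum_distrib_left sum.distrib[symmetric]
  proof (intro sum.cong refl)
    fix p assume "p \<in> {p. prime p \<and> p \<le> n}"
    then have "p > 1" using prime_gt_1_nat by blast
    then show "real n / (real p - 1) * ln (real p)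
       = real n * (ln (real p) / real p + ln (real p) / (real p * (real p - 1)))"
      by (simp add: divide_simps) (simp add: algebra_simps)
  qed
  also have "\<dots> \<le> real n * ((\<Sum>p | prime p \<and> p \<le> n. ln (real p) / real p) + ln 4)"
  proof (intro mult_left_mono add_left_mono)
    have "(\<Sum>p | prime p \<and> p \<le> n. ln (real p) / (real p * (real p - 1)))
        \<le> (\<Sum>m=2..n. ln (real m) / (real m * (real m - 1)))"
      by (rule sum_mono2) (auto dest: prime_ge_2_nat)
    also have "\<dots> \<le> ln 4 - (ln (real n) + ln 4) / real n"
      using sum_ln_over_pronic_le[of n] assms by simp
    also have "\<dots> \<le> ln 4" using assms by simp
    finally show "(\<Sum>p | prime p \<and> p \<le> n. ln (real p) / (real p * (real p - 1))) \<le> ln 4" .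
  qed auto
  finally have "real n * (- 1 - ln 4 + 1 / real n) \<le> real n * mertens_err n"
    using assms by (simp add: mertens_err_def algebra_simps)
  then show ?thesis using assms by (simp only: mult_le_cancel_left_pos of_nat_0_less_iff)
qed

section \<open>Partial summation\<close>

definition prime_recip_sum :: "nat \<Rightarrow> real" where
  "prime_recip_sum n = (\<Sum>p | prime p \<and> p \<le> n. 1 / real p)"

definition mertens_diff :: "nat \<Rightarrow> real" where
  "mertens_diff n = prime_recip_sum n - ln (ln (real n))"

lemma sum_primes_Suc:
  "(\<Sum>p | prime p \<and> p \<le> Suc n. f p) = (\<Sum>p | prime p \<and> p \<le> n. f p) + (if prime (Suc n) then f (Suc n) else (0::real))"
proof -
  have "{p. prime p \<and> p \<le> Suc n} = (if prime (Suc n) then insert (Suc n) {p. prime p \<and> p \<le> n} else {p. prime p \<and> p \<le> n})"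
    by (auto simp: le_Suc_eq)
  then show ?thesis by simp
qed

text \<open>One step of Abel summation with weights \<open>w k = 1 / ln k\<close>. With
  \<open>A = (\<Sum>p\<le>n. ln p / p)\<close>, \<open>u = ln n\<close> and \<open>v = ln (n + 1)\<close> the increment is
  \<open>A * (1/u - 1/v) - ln (v/u)\<close>, which is the integral of \<open>(A - t) / t\<^sup>2\<close> over \<open>[u, v]\<close>.
  The bounds of Mertens' first theorem put \<open>A - t\<close> between \<open>- 1 - ln 4\<close> and
  \<open>ln 4\<close> there; the proof replaces the integral by \<open>ln y \<le> y - 1\<close>.\<close>
lemma mertens_diff_step:
  assumes "n \<ge> 2"
  defines "w \<equiv> \<lambda>k::nat. 1 / ln (real k)"
  defines "d \<equiv> (mertens_diff (Suc n) - mertens_err (Suc n) * w (Suc n)) - (mertens_diff n - mertens_err n * w n)"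
  shows "d \<le> ln 4 * (w n - w (Suc n))" and "d \<ge> (- 1 - ln 4) * (w n - w (Suc n))"
proof -
  define u v where "u = ln (real n)" and "v = ln (real (Suc n))"
  define A where "A = (\<Sum>p | prime p \<and> p \<le> n. ln (real p) / real p)"
  have u0: "u > 0" and uv: "u < v" using assms by (auto simp: u_def v_def)
  then have v0: "v > 0" by simp
  \<comment> \<open>If \<open>n + 1\<close> is prime, its term \<open>c = 1 / (n + 1)\<close> in the sum of reciprocals cancels against
     its term in \<open>mertens_err (n + 1) / v\<close>.\<close>
  have d: "d = A * (1 / u - 1 / v) - ln (v / u)"
  proof -
    define c where "c = (if prime (Suc n) then 1 / real (Suc n) else 0)"
    have "mertens_err (Suc n) = A + c * v - v"
      by (simp add: mertens_err_def sum_primes_Suc A_def v_def c_def)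
    then have "mertens_err (Suc n) * (1 / v) = A / v + c - 1"
      using v0 by (simp add: field_simps)
    moreover have "mertens_err n * (1 / u) = A / u - 1"
      using u0 by (simp add: mertens_err_def A_def u_def[symmetric] diff_divide_distrib)
    moreover have "prime_recip_sum (Suc n) = prime_recip_sum n + c"
      unfolding prime_recip_sum_def c_def by (rule sum_primes_Suc)
    moreover have "ln (v / u) = ln v - ln u" using u0 v0 by (simp add: ln_div)
    ultimately show ?thesis
      unfolding d_def w_def mertens_diff_def u_def[symmetric] v_def[symmetric]
      by (simp add: algebra_simps)
  qed
  have w: "w n - w (Suc n) = 1 / u - 1 / v" by (simp add: w_def u_def v_def)
  have w0: "1 / u - 1 / v \<ge> 0" using u0 uv by (simp add: field_simps)
  have "A \<le> ln 4 + u"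
    using mertens_err_upper[of n] assms by (simp add: mertens_err_def A_def u_def)
  then have "A * (1 / u - 1 / v) \<le> (ln 4 + u) * (1 / u - 1 / v)"
    by (intro mult_right_mono w0)
  also have "\<dots> = ln 4 * (1 / u - 1 / v) + (1 - u / v)" using u0 v0 by (simp add: field_simps)
  also have "1 - u / v \<le> ln (v / u)"
    using ln_le_minus_one[of "u / v"] u0 v0 by (simp add: ln_div)
  finally show "d \<le> ln 4 * (w n - w (Suc n))" unfolding d w by simp
  have "v - u \<le> 1 / real n"
    using ln_Suc_minus_ln_le[of n] assms by (simp add: u_def v_def)
  then have "A \<ge> - 1 - ln 4 + v"
    using mertens_err_lower[of n] assms by (simp add: mertens_err_def A_def u_def)
  then have "A * (1 / u - 1 / v) \<ge> (- 1 - ln 4 + v) * (1 / u - 1 / v)"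
    by (intro mult_right_mono w0)
  also have "(- 1 - ln 4 + v) * (1 / u - 1 / v) = (- 1 - ln 4) * (1 / u - 1 / v) + (v / u - 1)"
    using u0 v0 by (simp add: field_simps)
  finally show "d \<ge> (- 1 - ln 4) * (w n - w (Suc n))"
    unfolding d w using ln_le_minus_one[of "v / u"] u0 v0 by simp
qed

lemma mertens_diff_change:
  assumes "n \<ge> 2" "n \<le> N"
  defines "w \<equiv> \<lambda>k::nat. 1 / ln (real k)"
  defines "d \<equiv> (mertens_diff N - mertens_err N * w N) - (mertens_diff n - mertens_err n * w n)"
  shows "d \<le> ln 4 * (w n - w N)" and "d \<ge> (- 1 - ln 4) * (w n - w N)"
proof -
  have "d \<le> ln 4 * (w n - w N) \<and> d \<ge> (- 1 - ln 4) * (w n - w N)"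
    using assms(2) unfolding d_def
  proof (induction N rule: dec_induct)
    case (step N)
    have "N \<ge> 2" using step assms(1) by simp
    note s = mertens_diff_step[OF this]
    have "ln 4 * (w n - w (Suc N)) = ln 4 * (w n - w N) + ln 4 * (w N - w (Suc N))"
         "(- 1 - ln 4) * (w n - w (Suc N)) = (- 1 - ln 4) * (w n - w N) + (- 1 - ln 4) * (w N - w (Suc N))"
      by (simp_all add: algebra_simps)
    with s step.IH show ?case unfolding w_def by linarith
  qed simp
  then show "d \<le> ln 4 * (w n - w N)" and "d \<ge> (- 1 - ln 4) * (w n - w N)" by auto
qed

lemma inverse_ln_tendsto_0: "(\<lambda>n. 1 / ln (real n)) \<longlonglongrightarrow> 0"
  by (intro tendsto_divide_0[OF tendsto_const] filterlim_at_top_imp_at_infinity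
      filterlim_compose[OF ln_at_top filterlim_real_sequentially])

lemma mertens_err_bounded: "n > 0 \<Longrightarrow> \<bar>mertens_err n\<bar> \<le> 1 + ln 4"
proof -
  assume n: "n > 0"
  have "1 / real n \<ge> 0" by simp
  then show ?thesis
    using mertens_err_upper[OF n] mertens_err_lower[OF n] by linarith
qed

lemma mertens_err_over_ln_tendsto_0: "(\<lambda>n. mertens_err n * (1 / ln (real n))) \<longlonglongrightarrow> 0"
proof (rule Lim_null_comparison)
  show "\<forall>\<^sub>F n in sequentially. norm (mertens_err n * (1 / ln (real n))) \<le> (1 + ln 4) * (1 / ln (real n))"
    using eventually_ge_at_top[of 2]
  proof eventually_elim
    case (elim n)
    then have "ln (real n) > 0" by simp
    then show ?case
      using mertens_err_bounded[of n] elim unfolding real_norm_def abs_mult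
      by (intro mult_mono) auto
  qed
  show "(\<lambda>n. (1 + ln 4) * (1 / ln (real n))) \<longlonglongrightarrow> 0"
    using tendsto_mult_right_zero[OF inverse_ln_tendsto_0] .
qed

lemma mertens_diff_convergent: "convergent mertens_diff"
proof -
  define w where "w = (\<lambda>k::nat. 1 / ln (real k))"
  define c where "c = (\<lambda>n. mertens_diff n - mertens_err n * w n)"
  have "Cauchy c"
  proof (rule CauchyI')
    fix e :: real assume e: "e > 0"
    have "(\<lambda>n. (1 + ln 4) * w n) \<longlonglongrightarrow> 0"
      unfolding w_def using tendsto_mult_right_zero[OF inverse_ln_tendsto_0] .
    then have "eventually (\<lambda>n. (1 + ln 4) * w n < e) sequentially"
      by (rule order_tendstoD) (rule e)
    then obtain M0 where M0: "\<And>n. n \<ge> M0 \<Longrightarrow> (1 + ln 4) * w n < e"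
      unfolding eventually_sequentially by auto
    show "\<exists>M. \<forall>m\<ge>M. \<forall>n>m. dist (c m) (c n) < e"
    proof (intro exI[of _ "max M0 2"] allI impI)
      fix m n assume mn: "max M0 2 \<le> m" "m < n"
      then have w: "0 \<le> w n" "w n \<le> w m" by (auto simp: w_def field_simps)
      note ch = mertens_diff_change[of m n]
      have "c n - c m \<le> ln 4 * (w m - w n)" "c n - c m \<ge> (- 1 - ln 4) * (w m - w n)"
        using ch mn by (auto simp: c_def w_def)
      moreover have "ln 4 * (w m - w n) \<le> (1 + ln 4) * w m"
        using w by (intro mult_mono) auto
      moreover have "(1 + ln 4) * (w m - w n) \<le> (1 + ln 4) * w m"
        using w by (intro mult_left_mono) auto
      ultimately have "\<bar>c m - c n\<bar> \<le> (1 + ln 4) * w m" by (simp add: abs_le_iff algebra_simps)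
      then show "dist (c m) (c n) < e" using M0[of m] mn by (simp add: dist_real_def)
    qed
  qed
  then have "convergent c" by (rule Cauchy_convergent)
  then have "convergent (\<lambda>n. c n + mertens_err n * w n)"
    unfolding w_def by (intro convergent_add convergentI[OF mertens_err_over_ln_tendsto_0])
  then show ?thesis by (simp add: c_def)
qed

definition mertens_const :: real where "mertens_const = lim mertens_diff"

lemma mertens_diff_LIMSEQ: "mertens_diff \<longlonglongrightarrow> mertens_const"
  unfolding mertens_const_def by (rule convergent_LIMSEQ_iff[THEN iffD1, OF mertens_diff_convergent])

text \<open>The limit \<open>N \<longrightarrow> \<infinity>\<close> of the telescoped increments. Keeping \<open>mertens_err n\<close> explicit matters:
  it enters with the opposite sign to the tail, so its bounds and those of the tail combine to the
  length of the interval of admissible errors.\<close>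
lemma mertens_diff_minus_const:
  assumes "n \<ge> 2"
  shows "mertens_diff n - mertens_const \<le> (mertens_err n + 1 + ln 4) / ln (real n)"
    and "mertens_diff n - mertens_const \<ge> (mertens_err n - ln 4) / ln (real n)"
proof -
  define w where "w = (\<lambda>k::nat. 1 / ln (real k))"
  define d where "d = (\<lambda>N. (mertens_diff N - mertens_err N * w N) - (mertens_diff n - mertens_err n * w n))"
  have lim: "d \<longlonglongrightarrow> (mertens_const - 0) - (mertens_diff n - mertens_err n * w n)"
    unfolding d_def w_def by (intro tendsto_diff mertens_diff_LIMSEQ mertens_err_over_ln_tendsto_0 tendsto_const)
  have limw: "(\<lambda>N. c * (w n - w N)) \<longlonglongrightarrow> c * (w n - 0)" for c
    unfolding w_def by (intro tendsto_intros inverse_ln_tendsto_0)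
  have "(mertens_const - 0) - (mertens_diff n - mertens_err n * w n) \<le> ln 4 * (w n - 0)"
    by (rule LIMSEQ_le[OF lim limw])
       (use mertens_diff_change(1)[OF assms] in \<open>auto simp: d_def w_def intro!: exI[of _ n]\<close>)
  then show "mertens_diff n - mertens_const \<ge> (mertens_err n - ln 4) / ln (real n)"
    by (simp add: w_def field_simps diff_divide_distrib)
  have "(mertens_const - 0) - (mertens_diff n - mertens_err n * w n) \<ge> (- 1 - ln 4) * (w n - 0)"
    by (rule LIMSEQ_le[OF limw lim])
       (use mertens_diff_change(2)[OF assms] in \<open>auto simp: d_def w_def intro!: exI[of _ n]\<close>)
  then show "mertens_diff n - mertens_const \<le> (mertens_err n + 1 + ln 4) / ln (real n)"
    by (simp add: w_def field_simps diff_divide_distrib add_divide_distrib)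
qed

lemma moebius_mu_prime_mult:
  assumes "prime p" "squarefree d" "\<not> p dvd d"
  shows "moebius_mu (p * d) = - moebius_mu d"
proof -
  have d: "d \<noteq> 0" using assms(2) by (cases "d = 0") auto
  have "coprime p d" using assms(1,3) by (rule prime_imp_coprime)
  then have "squarefree (p * d)"
    by (rule squarefree_mult_coprime[OF _ squarefree_prime[OF assms(1)] assms(2)])
  moreover have "prime_factors (p * d) = insert p (prime_factors d)"
    using assms(1) d prime_gt_0_nat[OF assms(1)]
    by (simp add: prime_factorization_mult prime_factorization_prime)
  moreover have "p \<notin> prime_factors d" using assms(3) by auto
  ultimately show ?thesis
    using assms(2) by (simp add: moebius_mu_def)
qed

section \<open>The Moebius function\<close>

text \<open>Fix a prime \<open>p\<close> dividing \<open>n\<close>. Multiplication by \<open>p\<close> pairs the squarefree divisors prime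
  to \<open>p\<close> with those divisible by \<open>p\<close>, and changes the sign of the Moebius function.\<close>
lemma sum_moebius_mu_divisors:
  assumes "n > 1"
  shows "(\<Sum>d | d dvd n. moebius_mu d) = 0"
proof -
  obtain p where p: "prime p" "p dvd n" using assms prime_factor_nat[of n] by auto
  define A where "A = {d. d dvd n \<and> squarefree d \<and> \<not> p dvd d}"
  define B where "B = {d. d dvd n \<and> squarefree d \<and> p dvd d}"
  have fin: "finite {d. d dvd n}" using assms by (intro finite_divisors_nat) auto
  then have finA: "finite A" and finB: "finite B"
    by (auto simp: A_def B_def elim: finite_subset[rotated])
  have "B = (*) p ` A"
  proof (intro equalityI subsetI)
    fix d assume d: "d \<in> B"
    then obtain k where k: "d = p * k" by (auto simp: B_def)
    have "\<not> p dvd k"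
    proof
      assume "p dvd k"
      then have "p ^ 2 dvd d" by (auto simp: k power2_eq_square)
      with d have "p dvd 1" unfolding B_def by (intro squarefreeD[of d p]) auto
      with p(1) show False by auto
    qed
    moreover have "squarefree k" "k dvd n"
      using d squarefree_multD(2)[of p k] dvd_mult_right[of p k n] by (auto simp: B_def k)
    ultimately show "d \<in> (*) p ` A" by (auto simp: A_def k)
  next
    fix d assume "d \<in> (*) p ` A"
    then obtain k where k: "d = p * k" "k \<in> A" by auto
    then have "coprime p k" using p(1) by (auto simp: A_def intro: prime_imp_coprime)
    then have "squarefree (p * k)" "p * k dvd n"
      using k p squarefree_prime[OF p(1)] by (auto simp: A_def intro: squarefree_mult_coprime divides_mult)
    then show "d \<in> B" using k by (auto simp: B_def)
  qed
  moreover have "inj_on ((*) p) A" using p(1) by (auto simp: inj_on_def)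
  ultimately have "sum moebius_mu B = (\<Sum>d\<in>A. moebius_mu (p * d))"
    by (simp add: sum.reindex)
  also have "\<dots> = - sum moebius_mu A"
    unfolding sum_negf[symmetric]
    by (intro sum.cong refl moebius_mu_prime_mult[OF p(1)]) (auto simp: A_def)
  finally have "sum moebius_mu A + sum moebius_mu B = 0" by simp
  also have "sum moebius_mu A + sum moebius_mu B = sum moebius_mu (A \<union> B)"
    using finA finB by (subst sum.union_disjoint) (auto simp: A_def B_def)
  also have "\<dots> = (\<Sum>d | d dvd n. moebius_mu d)"
    by (rule sum.mono_neutral_left[OF fin]) (auto simp: A_def B_def moebius_mu_def)
  finally show ?thesis by simp
qed

lemma abs_moebius_mu_le: "\<bar>moebius_mu n\<bar> \<le> 1"
  by (simp add: moebius_mu_def power_abs)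

lemma has_sum_nat_shift:
  fixes f :: "nat \<Rightarrow> 'a :: topological_comm_monoid_add"
  shows "(f has_sum S) {k..} \<longleftrightarrow> ((\<lambda>n. f (n + k)) has_sum S) UNIV"
proof -
  have "bij_betw (\<lambda>n. n + k) UNIV {k..}"
    by (rule bij_betwI[where g = "\<lambda>n. n - k"]) auto
  from has_sum_reindex_bij_betw[OF this, of f S] show ?thesis by simp
qed

lemma has_sum_minus_ln_one_minus:
  fixes y :: real
  assumes "0 \<le> y" "y < 1"
  shows "((\<lambda>k. y ^ k / real k) has_sum (- ln (1 - y))) {1..}"
proof -
  have "(\<lambda>n. y ^ n / real n) sums (- ln (1 - y))"
    using sums_minus[OF ln_series'[of "- y"]] assms by simp
  then have "((\<lambda>n. y ^ n / real n) has_sum (- ln (1 - y))) UNIV"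
    by (rule sums_nonneg_imp_has_sum) (use assms in auto)
  then show ?thesis
    by (rule has_sum_cong_neutral[THEN iffD1, rotated -1]) auto
qed

text \<open>Moebius inversion of \<open>- ln (1 - x) = (\<Sum>k\<ge>1. x ^ k / k)\<close>: the left side is the double sum of
  \<open>\<mu> m * x ^ (m * k) / (m * k)\<close>, and grouping it by \<open>N = m * k\<close> leaves only \<open>N = 1\<close>. The double sum
  converges absolutely because \<open>m * k \<ge> (m - 1) + k\<close>, so a product of two geometric series
  dominates it.\<close>
lemma has_sum_moebius_ln:
  fixes x :: real
  assumes "0 \<le> x" "x < 1"
  shows "((\<lambda>m. moebius_mu m / real m * (- ln (1 - x ^ m))) has_sum x) {1..}"
proof -
  define f where "f = (\<lambda>(m, k). real_of_int (moebius_mu m) / real m * ((x ^ m) ^ k / real k))"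
  let ?N = "{1::nat..}"
  have "(\<lambda>(m, k). x ^ (m - 1) * x ^ k) summable_on ?N \<times> ?N"
  proof (rule summable_on_SigmaI)
    fix m :: nat
    have "((\<lambda>k. x ^ k) has_sum (x / (1 - x))) ?N"
      using assms by (intro has_sum_geometric_from_1) auto
    from has_sum_cmult_right[OF this]
    show "((\<lambda>k. case (m, k) of (m, k) \<Rightarrow> x ^ (m - 1) * x ^ k) has_sum (x ^ (m - 1) * (x / (1 - x)))) ?N"
      by simp
  next
    have "summable (\<lambda>m. x ^ m * (x / (1 - x)))"
      using assms by (intro summable_mult2 summable_geometric) auto
    then have "(\<lambda>m. x ^ m * (x / (1 - x))) summable_on UNIV"
      using assms by (intro summable_nonneg_imp_summable_on) auto
    then show "(\<lambda>m. x ^ (m - 1) * (x / (1 - x))) summable_on ?N"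
      unfolding summable_on_def has_sum_nat_shift by simp
  qed (use assms in auto)
  then have "(\<lambda>z. norm (f z)) summable_on ?N \<times> ?N"
  proof (rule Infinite_Sum.abs_summable_on_comparison_test')
    fix z assume "z \<in> ?N \<times> ?N"
    then obtain m k where z: "z = (m, k)" "m \<ge> 1" "k \<ge> 1" by auto
    have "norm (f z) = \<bar>real_of_int (moebius_mu m)\<bar> / (real m * real k) * x ^ (m * k)"
      using assms by (simp add: z f_def abs_mult power_mult)
    also have "\<dots> \<le> 1 * x ^ (m * k)"
    proof (intro mult_right_mono)
      have "\<bar>real_of_int (moebius_mu m)\<bar> \<le> 1" using abs_moebius_mu_le[of m] by linarith
      moreover have "1 * 1 \<le> real m * real k" using z by (intro mult_mono) auto
      ultimately show "\<bar>real_of_int (moebius_mu m)\<bar> / (real m * real k) \<le> 1"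
        by (simp add: divide_le_eq_1)
    qed (use assms in auto)
    also have "x ^ (m * k) \<le> x ^ ((m - 1) + k)"
    proof (rule power_decreasing)
      obtain a b where "m = Suc a" "k = Suc b"
        using z by (metis Suc_le_D One_nat_def)
      then show "m - 1 + k \<le> m * k" by simp
    qed (use assms in auto)
    finally show "norm (f z) \<le> (case z of (m, k) \<Rightarrow> x ^ (m - 1) * x ^ k)"
      by (simp add: z power_add)
  qed
  then have "f summable_on ?N \<times> ?N" by (rule abs_summable_summable)
  then obtain S where S: "(f has_sum S) (?N \<times> ?N)" by (auto simp: summable_on_def)
  have rows: "((\<lambda>m. real_of_int (moebius_mu m) / real m * (- ln (1 - x ^ m))) has_sum S) ?N"
  proof (rule has_sum_SigmaD[OF S])
    fix m assume "m \<in> ?N"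
    then have "x ^ m < 1" using assms by (auto simp: power_less_one_iff Suc_le_eq)
    then have "((\<lambda>k. (x ^ m) ^ k / real k) has_sum (- ln (1 - x ^ m))) ?N"
      using assms by (intro has_sum_minus_ln_one_minus) auto
    from has_sum_cmult_right[OF this, of "real_of_int (moebius_mu m) / real m"]
    show "((\<lambda>k. f (m, k)) has_sum (real_of_int (moebius_mu m) / real m * (- ln (1 - x ^ m)))) ?N"
      by (simp only: f_def prod.case)
  qed
  \<comment> \<open>The same double sum, grouped by the product \<open>N = m * k\<close>, with \<open>d\<close> for \<open>m\<close>.\<close>
  have "bij_betw (\<lambda>(N, d). (d, N div d)) (SIGMA N:?N. {d. d dvd N}) (?N \<times> ?N)"
    by (rule bij_betwI[where g = "\<lambda>(m, k). (m * k, m)"])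
       (auto simp: dvd_div_eq_0_iff Suc_le_eq dest: dvd_pos_nat intro!: Nat.gr0I)
  from has_sum_reindex_bij_betw[OF this, of f S] S
  have "((\<lambda>(N, d). f (d, N div d)) has_sum S) (SIGMA N:?N. {d. d dvd N})"
    by (simp add: case_prod_unfold)
  then have "((\<lambda>N. if N = 1 then x else 0) has_sum S) ?N"
  proof (rule has_sum_SigmaD)
    fix N assume N: "N \<in> ?N"
    then have fin: "finite {d. d dvd N}" by (intro finite_divisors_nat) auto
    have "(\<Sum>d | d dvd N. f (d, N div d)) = (\<Sum>d | d dvd N. real_of_int (moebius_mu d)) * (x ^ N / real N)"
      unfolding sum_distrib_right
    proof (rule sum.cong)
      fix d assume "d \<in> {d. d dvd N}"
      then obtain k where k: "N = d * k" by auto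
      with N have "d > 0" "k > 0" by auto
      then show "f (d, N div d) = real_of_int (moebius_mu d) * (x ^ N / real N)"
        by (simp add: f_def k power_mult)
    qed simp
    also have "(\<Sum>d | d dvd N. real_of_int (moebius_mu d)) = (if N = 1 then 1 else 0)"
      using sum_moebius_mu_divisors[of N] N
      by (auto simp flip: of_int_sum simp: moebius_mu_def)
    finally show "((\<lambda>d. case (N, d) of (N, d) \<Rightarrow> f (d, N div d)) has_sum (if N = 1 then x else 0)) {d. d dvd N}"
      using fin by (intro has_sum_finiteI) auto
  qed
  moreover have "((\<lambda>N. if N = 1 then x else 0) has_sum x) ?N"
    by (rule has_sum_finite_neutralI[of "{1}"]) auto
  ultimately have "S = x" by (rule has_sum_unique)
  with rows show ?thesis by simp
qed

section \<open>The Euler product\<close>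

lemma summable_on_powr_minus:
  fixes s :: real
  assumes "s > 1"
  shows "(\<lambda>n::nat. real n powr - s) summable_on UNIV"
  using assms by (intro summable_nonneg_imp_summable_on) (auto simp: summable_real_powr_iff)

lemma has_sum_riemann_zeta:
  assumes "s > 1"
  shows "((\<lambda>n::nat. real n powr - s) has_sum riemann_zeta s) {1..}"
proof -
  have "((\<lambda>n::nat. real n powr - s) summable_on {1..})"
    by (rule summable_on_subset[OF summable_on_powr_minus[OF assms]]) auto
  then obtain S where S: "((\<lambda>n::nat. real n powr - s) has_sum S) {1..}" by (auto simp: summable_on_def)
  then have "(\<lambda>n. real (n + 1) powr - s) sums S"
    unfolding has_sum_nat_shift by (rule has_sum_imp_sums)
  then have "riemann_zeta s = S"
    unfolding riemann_zeta_def by (simp add: sums_iff powr_minus_divide)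
  with S show ?thesis by simp
qed

text \<open>The sieve of Eratosthenes: among the integers free of primes in \<open>A\<close>, the multiples of a further
  prime \<open>p\<close> are \<open>p\<close> times such integers, so removing them multiplies the sum by
  \<open>1 - p powr - s\<close>.\<close>
lemma has_sum_sieve:
  fixes s :: real and A :: "nat set"
  assumes "s > 1" "finite A" "\<And>p. p \<in> A \<Longrightarrow> prime p"
  shows "((\<lambda>n. real n powr - s) has_sum (riemann_zeta s * (\<Prod>p\<in>A. 1 - real p powr - s))) {n. n \<ge> 1 \<and> (\<forall>p\<in>A. \<not> p dvd n)}"
  using assms(2,3)
proof (induction A rule: finite_induct)
  case empty
  then show ?case using has_sum_riemann_zeta[OF assms(1)] by (simp add: atLeast_def)
next
  case (insert p A)
  let ?f = "\<lambda>n::nat. real n powr - s"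
  let ?S = "{n. n \<ge> 1 \<and> (\<forall>q\<in>A. \<not> q dvd n)}"
  let ?Z = "riemann_zeta s * (\<Prod>p\<in>A. 1 - real p powr - s)"
  have p: "prime p" using insert by auto
  have IH: "(?f has_sum ?Z) ?S" using insert by auto
  have "bij_betw ((*) p) ?S {n \<in> ?S. p dvd n}"
  proof (rule bij_betwI[where g = "\<lambda>n. n div p"])
    have np: "\<not> q dvd p" if "q \<in> A" for q
      using that insert p by (metis insertCI primes_dvd_imp_eq)
    show "(*) p \<in> ?S \<rightarrow> {n \<in> ?S. p dvd n}"
      using np insert.prems p prime_gt_0_nat[OF p] by (auto simp: prime_dvd_mult_iff Suc_le_eq)
    show "(\<lambda>n. n div p) \<in> {n \<in> ?S. p dvd n} \<rightarrow> ?S"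
      by (auto simp: Suc_le_eq elim!: dvdE)
  qed (use prime_gt_0_nat[OF p] in auto)
  from has_sum_reindex_bij_betw[OF this, of ?f]
  have "(?f has_sum (real p powr - s * ?Z)) {n \<in> ?S. p dvd n}"
    using has_sum_cmult_right[OF IH, of "real p powr - s"] by (simp add: powr_mult)
  from has_sum_Diff[OF IH this]
  have "(?f has_sum (?Z - real p powr - s * ?Z)) (?S - {n \<in> ?S. p dvd n})" by auto
  moreover have "?S - {n \<in> ?S. p dvd n} = {n. n \<ge> 1 \<and> (\<forall>q\<in>insert p A. \<not> q dvd n)}" by auto
  moreover have "?Z - real p powr - s * ?Z = riemann_zeta s * (\<Prod>p\<in>insert p A. 1 - real p powr - s)"
    using insert by (simp add: algebra_simps)
  ultimately show ?case by metis
qed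

lemma prime_powr_minus_bounds:
  assumes "prime p" "s > 0"
  shows "0 < real p powr - s" "real p powr - s < 1"
  using prime_gt_1_nat[OF assms(1)] assms(2) powr_less_mono[of "- s" 0 "real p"] by auto

text \<open>What the sieve by all primes below \<open>N\<close> leaves is \<open>1\<close> and some integers \<open>\<ge> N\<close>.\<close>
lemma riemann_zeta_euler_product_bounds:
  assumes "s > 1"
  defines "Z \<equiv> \<lambda>N. riemann_zeta s * (\<Prod>p | prime p \<and> p < N. 1 - real p powr - s)"
  shows "1 \<le> Z N" and "N \<ge> 2 \<Longrightarrow> Z N \<le> 1 + (\<Sum>n. real (n + N) powr - s)"
proof -
  let ?f = "\<lambda>n::nat. real n powr - s"
  let ?A = "{p. prime p \<and> p < N}"
  let ?S = "{n. n \<ge> 1 \<and> (\<forall>p\<in>?A. \<not> p dvd n)}"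
  have sieve: "(?f has_sum Z N) ?S"
    unfolding Z_def by (rule has_sum_sieve[OF assms(1)]) auto
  have one: "(?f has_sum 1) {1}" by (rule has_sum_finiteI) auto
  show "1 \<le> Z N"
    by (rule has_sum_mono'[OF one sieve]) (auto dest: prime_gt_1_nat)
  have "summable (\<lambda>n. real n powr - s)" using assms by (auto simp: summable_real_powr_iff)
  then have "(\<lambda>n. real (n + N) powr - s) sums (\<Sum>n. real (n + N) powr - s)"
    by (intro summable_sums) (simp only: summable_iff_shift[of ?f N])
  then have tail: "(?f has_sum (\<Sum>n. real (n + N) powr - s)) {N..}"
    unfolding has_sum_nat_shift by (rule sums_nonneg_imp_has_sum) auto
  show "Z N \<le> 1 + (\<Sum>n. real (n + N) powr - s)" if "N \<ge> 2"
  proof (rule has_sum_mono'[OF sieve has_sum_Un_disjoint[OF one tail]])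
    show "?S \<subseteq> {1} \<union> {N..}"
    proof
      fix n assume n: "n \<in> ?S"
      show "n \<in> {1} \<union> {N..}"
      proof (cases "n = 1")
        case False
        then obtain p where "prime p" "p dvd n" using prime_factor_nat[of n] by auto
        then have "N \<le> p" "p \<le> n" using n by (auto intro: dvd_imp_le leI)
        then show ?thesis by simp
      qed simp
    qed
  qed (use that in auto)
qed

lemma has_sum_primes_iff_sums:
  fixes f :: "nat \<Rightarrow> real"
  assumes "\<And>p. prime p \<Longrightarrow> f p \<ge> 0"
  shows "(f has_sum S) {p. prime p} \<longleftrightarrow> (\<lambda>n. if prime n then f n else 0) sums S"
proof -
  have "(f has_sum S) {p. prime p} \<longleftrightarrow> ((\<lambda>n. if prime n then f n else 0) has_sum S) UNIV"
    by (rule has_sum_cong_neutral) auto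
  also have "\<dots> \<longleftrightarrow> (\<lambda>n. if prime n then f n else 0) sums S"
    using assms by (auto dest: has_sum_imp_sums intro: sums_nonneg_imp_has_sum)
  finally show ?thesis .
qed

theorem ln_riemann_zeta_euler_product:
  assumes "s > 1"
  shows "((\<lambda>p. - ln (1 - real p powr - s)) has_sum ln (riemann_zeta s)) {p. prime p}"
proof -
  define Z where "Z = (\<lambda>N. riemann_zeta s * (\<Prod>p | prime p \<and> p < N. 1 - real p powr - s))"
  have bounds: "0 < 1 - real p powr - s" "1 - real p powr - s < 1" if "prime p" for p
    using prime_powr_minus_bounds[OF that, of s] assms by auto
  have Z1: "1 \<le> Z N" for N
    unfolding Z_def by (rule riemann_zeta_euler_product_bounds(1)[OF assms])
  from Z1[of 0] have zeta: "riemann_zeta s \<ge> 1" by (simp add: Z_def)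
  have "summable (\<lambda>n. real n powr - s)" using assms by (auto simp: summable_real_powr_iff)
  then have "(\<lambda>N. \<Sum>n. real (n + N) powr - s) \<longlonglongrightarrow> 0" by (rule suminf_exist_split2)
  then have "(\<lambda>N. 1 + (\<Sum>n. real (n + N) powr - s)) \<longlonglongrightarrow> 1 + 0" by (intro tendsto_intros)
  then have "Z \<longlonglongrightarrow> 1"
    using Z1 riemann_zeta_euler_product_bounds(2)[OF assms]
    by (intro tendsto_sandwich[of "\<lambda>_. 1" Z sequentially "\<lambda>N. 1 + (\<Sum>n. real (n + N) powr - s)"])
       (auto simp: Z_def eventually_sequentially)
  then have "(\<lambda>N. ln (riemann_zeta s) - ln (Z N)) \<longlonglongrightarrow> ln (riemann_zeta s) - ln 1"
    by (intro tendsto_intros) auto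
  moreover have "ln (riemann_zeta s) - ln (Z N) = (\<Sum>n<N. if prime n then - ln (1 - real n powr - s) else 0)" for N
  proof -
    have "(\<Sum>n<N. if prime n then - ln (1 - real n powr - s) else 0) = (\<Sum>n | prime n \<and> n < N. - ln (1 - real n powr - s))"
      by (rule sum.mono_neutral_cong_right) auto
    also have "\<dots> = - ln (\<Prod>n | prime n \<and> n < N. 1 - real n powr - s)"
    proof (subst ln_prod)
      show "1 - real n powr - s \<noteq> 0" if "n \<in> {n. prime n \<and> n < N}" for n
        using bounds(1)[of n] that by simp
    qed (auto simp: sum_negf)
    also have "\<dots> = ln (riemann_zeta s) - ln (Z N)"
    proof -
      have "0 < (\<Prod>n | prime n \<and> n < N. 1 - real n powr - s)"
        by (rule prod_pos) (use bounds in auto)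
      then show ?thesis using zeta unfolding Z_def by (subst ln_mult_pos) auto
    qed
    finally show ?thesis by simp
  qed
  ultimately have "(\<lambda>n. if prime n then - ln (1 - real n powr - s) else 0) sums ln (riemann_zeta s)"
    by (simp add: sums_def)
  then show ?thesis
    using bounds by (subst has_sum_primes_iff_sums) (auto simp: ln_le_zero_iff less_imp_le)
qed

section \<open>A series over primes as a series of logarithms of zeta\<close>

lemma minus_ln_one_minus_bounds:
  fixes y :: real
  assumes "0 \<le> y" "y \<le> 1 / 2"
  shows "y \<le> - ln (1 - y)" and "- ln (1 - y) \<le> y + 2 * y\<^sup>2"
  using ln_le_minus_one[of "1 - y"] ln_one_minus_pos_lower_bound[of y] assms by auto

definition prime_log_sum :: real where
  "prime_log_sum = (\<Sum>\<^sub>\<infinity>p | prime p. 1 / real p + ln (1 - 1 / real p))"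

lemma summable_on_primes_inverse_square: "(\<lambda>p. c * (1 / real p) ^ 2) summable_on {p. prime p}"
proof -
  have "(\<lambda>n::nat. real n powr - 2) summable_on {p. prime p}"
    by (rule summable_on_subset[OF summable_on_powr_minus]) auto
  then have "(\<lambda>n::nat. (1 / real n) ^ 2) summable_on {p. prime p}"
    by (rule summable_on_cong[THEN iffD1, rotated]) (auto simp: powr_minus_divide power_divide prime_gt_0_nat)
  then show ?thesis by (rule summable_on_cmult_right)
qed

text \<open>Inserting the Euler product gives a double sum over primes \<open>p\<close> and \<open>m \<ge> 2\<close>, dominated by
  \<open>2 * p powr - m\<close>. Summed over \<open>m\<close> first, \<open>has_sum_moebius_ln\<close> at \<open>x = 1 / p\<close> applies, except
  that its term \<open>m = 1\<close>, namely \<open>- ln (1 - 1 / p)\<close>, is absent.\<close>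
theorem sums_moebius_ln_riemann_zeta:
  "(\<lambda>k. real_of_int (moebius_mu (k + 2)) * ln (riemann_zeta (real (k + 2))) / real (k + 2)) sums prime_log_sum"
proof -
  let ?P = "{p::nat. prime p}"
  define g where "g = (\<lambda>(p, m). real_of_int (moebius_mu m) / real m * (- ln (1 - (1 / real p) ^ m)))"
  have half: "0 < 1 / real p" "1 / real p \<le> 1 / 2" if "prime p" for p
    using prime_ge_2_nat[OF that] by auto
  have pow: "(1 / real p) ^ m \<le> 1 / 2" if "prime p" "m \<ge> 2" for p m
  proof -
    have "(1 / real p) ^ m \<le> (1 / real p) ^ 1"
      using half[OF that(1)] that(2) by (intro power_decreasing) auto
    then show ?thesis using half[OF that(1)] power_one_right[of "1 / real p"] by linarith
  qed
  have "(\<lambda>(p, m). 2 * (1 / real p) ^ m) summable_on ?P \<times> {2..}"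
  proof (rule summable_on_SigmaI)
    fix p :: nat assume p: "p \<in> ?P"
    have "(\<lambda>m. (1 / real p) ^ m) sums (1 / (1 - 1 / real p))"
      using half[of p] p by (intro geometric_sums) auto
    from sums_mult[OF this, of "2 * (1 / real p) ^ 2"]
    have "(\<lambda>m. 2 * (1 / real p) ^ (m + 2)) sums (2 * (1 / real p) ^ 2 / (1 - 1 / real p))"
      unfolding power_add by (simp only: mult_ac times_divide_eq_right mult_1_left mult_1_right)
    then have "((\<lambda>m. 2 * (1 / real p) ^ m) has_sum (2 * (1 / real p) ^ 2 / (1 - 1 / real p))) {2..}"
      unfolding has_sum_nat_shift by (rule sums_nonneg_imp_has_sum) auto
    then show "((\<lambda>m. case (p, m) of (p, m) \<Rightarrow> 2 * (1 / real p) ^ m) has_sum (2 * (1 / real p) ^ 2 / (1 - 1 / real p))) {2..}"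
      by simp
  next
    show "(\<lambda>p. 2 * (1 / real p) ^ 2 / (1 - 1 / real p)) summable_on ?P"
    proof (rule summable_on_comparison_test[OF summable_on_primes_inverse_square[of 4]])
      fix p :: nat assume "p \<in> ?P"
      then have h: "0 < 1 / real p" "1 / real p \<le> 1 / 2" using half by auto
      then show "0 \<le> 2 * (1 / real p) ^ 2 / (1 - 1 / real p)" by (intro divide_nonneg_nonneg) auto
      have "2 * (1 / real p) ^ 2 / (1 - 1 / real p) \<le> 2 * (1 / real p) ^ 2 / (1 / 2)"
        using h by (intro divide_left_mono) auto
      then show "2 * (1 / real p) ^ 2 / (1 - 1 / real p) \<le> 4 * (1 / real p) ^ 2" by simp
    qed
  qed auto
  then have "(\<lambda>z. norm (g z)) summable_on ?P \<times> {2..}"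
  proof (rule Infinite_Sum.abs_summable_on_comparison_test')
    fix z assume "z \<in> ?P \<times> {2::nat..}"
    then obtain p m where z: "z = (p, m)" "prime p" "m \<ge> 2" by auto
    have y: "0 \<le> (1 / real p) ^ m" "(1 / real p) ^ m \<le> 1 / 2" using pow[OF z(2,3)] by auto
    have "\<bar>real_of_int (moebius_mu m)\<bar> \<le> 1" using abs_moebius_mu_le[of m] by linarith
    then have "\<bar>real_of_int (moebius_mu m)\<bar> / real m \<le> 1" using z by (simp add: divide_le_eq_1)
    moreover have "0 \<le> - ln (1 - (1 / real p) ^ m)" "- ln (1 - (1 / real p) ^ m) \<le> 2 * (1 / real p) ^ m"
    proof -
      let ?y = "(1 / real p) ^ m"
      have "2 * ?y\<^sup>2 \<le> ?y" using y mult_right_mono[of ?y "1 / 2" ?y] by (simp add: power2_eq_square)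
      then show "0 \<le> - ln (1 - ?y)" "- ln (1 - ?y) \<le> 2 * ?y"
        using minus_ln_one_minus_bounds[OF y] y(1) by linarith+
    qed
    ultimately have "\<bar>real_of_int (moebius_mu m)\<bar> / real m * (- ln (1 - (1 / real p) ^ m)) \<le> 1 * (2 * (1 / real p) ^ m)"
      by (intro mult_mono) auto
    then show "norm (g z) \<le> (case z of (p, m) \<Rightarrow> 2 * (1 / real p) ^ m)"
      using \<open>0 \<le> - ln (1 - (1 / real p) ^ m)\<close> by (simp add: z g_def abs_mult)
  qed
  then have "g summable_on ?P \<times> {2..}" by (rule abs_summable_summable)
  then obtain S where S: "(g has_sum S) (?P \<times> {2..})" by (auto simp: summable_on_def)
  have "((\<lambda>p. 1 / real p + ln (1 - 1 / real p)) has_sum S) ?P"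
  proof (rule has_sum_SigmaD[OF S])
    fix p :: nat assume p: "p \<in> ?P"
    have "((\<lambda>m. g (p, m)) has_sum (1 / real p)) {1..}"
      using half[of p] p has_sum_moebius_ln[of "1 / real p"] by (simp add: g_def)
    moreover have "((\<lambda>m. g (p, m)) has_sum (- ln (1 - 1 / real p))) {1}"
      by (rule has_sum_finiteI) (auto simp: g_def moebius_mu_def)
    ultimately have "((\<lambda>m. g (p, m)) has_sum (1 / real p - (- ln (1 - 1 / real p)))) ({1..} - {1})"
      by (rule has_sum_Diff) auto
    moreover have "{1..} - {1} = {2::nat..}" by auto
    ultimately show "((\<lambda>m. g (p, m)) has_sum (1 / real p + ln (1 - 1 / real p))) {2..}" by simp
  qed
  then have "S = prime_log_sum" unfolding prime_log_sum_def by (simp add: infsumI)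
  have "((\<lambda>(m, p). g (p, m)) has_sum S) ({2..} \<times> ?P)"
    using S by (subst (asm) has_sum_swap)
  then have "((\<lambda>m. real_of_int (moebius_mu m) / real m * ln (riemann_zeta (real m))) has_sum S) {2..}"
  proof (rule has_sum_SigmaD)
    fix m :: nat assume m: "m \<in> {2..}"
    have "((\<lambda>p. - ln (1 - real p powr - real m)) has_sum ln (riemann_zeta (real m))) ?P"
      using m by (intro ln_riemann_zeta_euler_product) auto
    also have "?this \<longleftrightarrow> ((\<lambda>p. - ln (1 - (1 / real p) ^ m)) has_sum ln (riemann_zeta (real m))) ?P"
      by (rule has_sum_cong) (auto simp: powr_minus_divide powr_realpow power_divide prime_gt_0_nat)
    finally have "((\<lambda>p. - ln (1 - (1 / real p) ^ m)) has_sum ln (riemann_zeta (real m))) ?P" .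
    from has_sum_cmult_right[OF this, of "real_of_int (moebius_mu m) / real m"]
    show "((\<lambda>p. case (m, p) of (m, p) \<Rightarrow> g (p, m)) has_sum
        (real_of_int (moebius_mu m) / real m * ln (riemann_zeta (real m)))) ?P"
      by (simp only: g_def prod.case)
  qed
  then have "(\<lambda>k. real_of_int (moebius_mu (k + 2)) / real (k + 2) * ln (riemann_zeta (real (k + 2)))) sums S"
    unfolding has_sum_nat_shift by (rule has_sum_imp_sums)
  then show ?thesis
    unfolding \<open>S = prime_log_sum\<close> by (simp only: times_divide_eq_left)
qed

section \<open>Laplace transforms of the two summatory functions\<close>

lemma has_bochner_integral_exp_minus_atLeast:
  "has_bochner_integral lborel (\<lambda>v::real. exp (- v) * indicator {a..} v) (exp (- a))"
proof (rule has_bochner_integral_nn_integral)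
  have "(\<integral>\<^sup>+ v. ennreal (exp (- v)) * indicator {a..} v \<partial>lborel) = ennreal (0 - (- exp (- a)))"
  proof (rule nn_integral_FTC_atLeast)
    show "((\<lambda>v::real. - exp (- v)) \<longlongrightarrow> 0) at_top" by real_asymp
  qed (auto intro!: derivative_eq_intros)
  moreover have "ennreal (exp (- v)) * indicator {a..} v = ennreal (exp (- v) * indicator {a..} v)" for v :: real
    by (auto simp: indicator_def)
  ultimately show "(\<integral>\<^sup>+ v. ennreal (exp (- v) * indicator {a..} v) \<partial>lborel) = ennreal (exp (- a))"
    by simp
qed auto

text \<open>A Dirichlet series \<open>\<Sum>j. c j * exp (- s * l j)\<close> is \<open>s\<close> times the Laplace transform of its
  summatory function, since \<open>exp (- s * l) = (\<integral>v\<ge>s * l. exp (- v))\<close>. Substituting \<open>v = s * u\<close>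
  puts the dependence on \<open>s\<close> into the argument of the summatory function, ready for dominated
  convergence.\<close>
lemma laplace_step_function:
  fixes c l :: "nat \<Rightarrow> real"
  assumes c: "\<And>j. c j \<ge> 0" and s: "s > 0"
    and fin: "\<And>u. finite {j. c j \<noteq> 0 \<and> l j \<le> u}"
    and S: "(\<lambda>j. c j * exp (- (s * l j))) sums S"
  shows "has_bochner_integral lborel (\<lambda>v. exp (- v) * (\<Sum>j | c j \<noteq> 0 \<and> l j \<le> v / s. c j)) S"
proof -
  define f where "f = (\<lambda>j v. c j * (exp (- v) * indicator {s * l j..} v) :: real)"
  have f: "has_bochner_integral lborel (f j) (c j * exp (- (s * l j)))" for j
    unfolding f_def by (intro has_bochner_integral_mult_right has_bochner_integral_exp_minus_atLeast)
  have fs: "(\<lambda>j. f j v) sums (exp (- v) * (\<Sum>j | c j \<noteq> 0 \<and> l j \<le> v / s. c j))" for v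
  proof -
    have "(\<lambda>j. f j v) sums (\<Sum>j | c j \<noteq> 0 \<and> l j \<le> v / s. f j v)"
      by (rule sums_finite[OF fin]) (use s in \<open>auto simp: f_def indicator_def field_simps\<close>)
    also have "(\<Sum>j | c j \<noteq> 0 \<and> l j \<le> v / s. f j v) = exp (- v) * (\<Sum>j | c j \<noteq> 0 \<and> l j \<le> v / s. c j)"
      unfolding sum_distrib_left using s by (intro sum.cong refl) (auto simp: f_def field_simps)
    finally show ?thesis .
  qed
  have nonneg: "norm (f j v) = f j v" for j v using c[of j] by (simp add: f_def)
  have 1: "\<And>j. integrable lborel (f j)" using f by (auto simp: has_bochner_integral_iff)
  have 2: "AE v in lborel. summable (\<lambda>j. norm (f j v))"
    unfolding nonneg using fs by (auto simp: sums_iff)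
  have int: "(LINT v|lborel. f j v) = c j * exp (- (s * l j))" for j
    using f by (auto simp: has_bochner_integral_iff)
  have 3: "summable (\<lambda>j. LINT v|lborel. norm (f j v))"
    unfolding nonneg int using S by (simp add: sums_iff)
  have eq: "(\<lambda>v. \<Sum>j. f j v) = (\<lambda>v. exp (- v) * (\<Sum>j | c j \<noteq> 0 \<and> l j \<le> v / s. c j))"
    using fs by (auto simp: sums_iff)
  show ?thesis
    using integrable_suminf[OF 1 2 3] integral_suminf[OF 1 2 3] S
    unfolding eq int has_bochner_integral_iff by (simp add: sums_iff)
qed

text \<open>Jumps \<open>1 / p\<close> at \<open>ln p\<close>.\<close>
lemma has_bochner_integral_prime_recip_sum:
  assumes "s > 0" and S: "(\<lambda>n. if prime n then real n powr - (1 + s) else 0) sums S"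
  shows "has_bochner_integral lborel (\<lambda>v. exp (- v) * prime_recip_sum (nat \<lfloor>exp (v / s)\<rfloor>)) S"
proof -
  define c :: "nat \<Rightarrow> real" where "c = (\<lambda>j. if prime j then 1 / real j else 0)"
  have set: "{j. c j \<noteq> 0 \<and> ln (real j) \<le> u} = {p. prime p \<and> p \<le> nat \<lfloor>exp u\<rfloor>}" for u
  proof -
    have "ln (real j) \<le> u \<longleftrightarrow> j \<le> nat \<lfloor>exp u\<rfloor>" if "prime j" for j
    proof -
      have "ln (real j) \<le> u \<longleftrightarrow> real j \<le> exp u" 
        using prime_gt_0_nat[OF that] exp_le_cancel_iff[of "ln (real j)" u] by simp
      also have "\<dots> \<longleftrightarrow> j \<le> nat \<lfloor>exp u\<rfloor>" by (simp add: le_nat_iff le_floor_iff)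
      finally show ?thesis .
    qed
    then show ?thesis by (auto simp: c_def dest: prime_gt_0_nat)
  qed
  have "has_bochner_integral lborel (\<lambda>v. exp (- v) * (\<Sum>j | c j \<noteq> 0 \<and> ln (real j) \<le> v / s. c j)) S"
  proof (rule laplace_step_function)
    have "c j * exp (- (s * ln (real j))) = (if prime j then real j powr - (1 + s) else 0)" for j
    proof (cases "prime j")
      case True
      have "real j powr - (1 + s) = real j powr (- 1 + - s)" by simp
      also have "\<dots> = real j powr - 1 * real j powr - s" by (rule powr_add)
      also have "real j powr - 1 = 1 / real j"
        using prime_gt_0_nat[OF True] by (simp add: powr_minus_divide)
      also have "real j powr - s = exp (- (s * ln (real j)))"
        using prime_gt_0_nat[OF True] by (simp only: powr_def) auto
      finally show ?thesis using True unfolding c_def by (simp only: if_True)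
    qed (simp add: c_def)
    with S show "(\<lambda>j. c j * exp (- (s * ln (real j)))) sums S" by simp
    show "finite {j. c j \<noteq> 0 \<and> ln (real j) \<le> u}" for u unfolding set by simp
  qed (use assms in \<open>auto simp: c_def\<close>)
  also have "(\<lambda>v. exp (- v) * (\<Sum>j | c j \<noteq> 0 \<and> ln (real j) \<le> v / s. c j)) =
      (\<lambda>v. exp (- v) * prime_recip_sum (nat \<lfloor>exp (v / s)\<rfloor>))"
    unfolding set prime_recip_sum_def
    by (intro ext arg_cong[where f = "\<lambda>t. _ * t"] sum.cong refl) (auto simp: c_def)
  finally show ?thesis .
qed

text \<open>Jumps \<open>1 / k\<close> at \<open>k\<close>. The harmonic numbers are a convenient comparison function: they grow
  like \<open>ln u + \<gamma>\<close> and their transform is elementary, so that no integral involving the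
  logarithm has to be evaluated to see \<open>\<gamma>\<close> appear.\<close>
lemma has_bochner_integral_harm:
  fixes s :: real
  assumes "s > 0"
  shows "has_bochner_integral lborel (\<lambda>v. exp (- v) * harm (nat \<lfloor>v / s\<rfloor>)) (- ln (1 - exp (- s)))"
proof -
  define c :: "nat \<Rightarrow> real" where "c = (\<lambda>j. 1 / real j)"
  have set: "{j. c j \<noteq> 0 \<and> real j \<le> u} = {1..nat \<lfloor>u\<rfloor>}" for u
    by (auto simp: c_def le_nat_iff le_floor_iff) linarith+
  have "has_bochner_integral lborel (\<lambda>v. exp (- v) * (\<Sum>j | c j \<noteq> 0 \<and> real j \<le> v / s. c j)) (- ln (1 - exp (- s)))"
  proof (rule laplace_step_function)
    have "((\<lambda>k. exp (- s) ^ k / real k) has_sum (- ln (1 - exp (- s)))) {1..}"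
      using assms by (intro has_sum_minus_ln_one_minus) auto
    then have "((\<lambda>k. exp (- s) ^ k / real k) has_sum (- ln (1 - exp (- s)))) UNIV"
      by (rule has_sum_cong_neutral[THEN iffD1, rotated -1]) auto
    from has_sum_imp_sums[OF this] show "(\<lambda>j. c j * exp (- (s * real j))) sums (- ln (1 - exp (- s)))"
      by (simp add: c_def mult.commute flip: exp_of_nat_mult)
    show "finite {j. c j \<noteq> 0 \<and> real j \<le> u}" for u unfolding set by simp
  qed (use assms in \<open>auto simp: c_def\<close>)
  also have "(\<lambda>v. exp (- v) * (\<Sum>j | c j \<noteq> 0 \<and> real j \<le> v / s. c j)) =
      (\<lambda>v. exp (- v) * harm (nat \<lfloor>v / s\<rfloor>))"
    unfolding set harm_def by (simp add: c_def inverse_eq_divide)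
  finally show ?thesis .
qed

section \<open>The value of Mertens' constant\<close>

definition prime_harm_diff :: "real \<Rightarrow> real" where
  "prime_harm_diff u = prime_recip_sum (nat \<lfloor>exp u\<rfloor>) - harm (nat \<lfloor>u\<rfloor>)"

lemma prime_harm_diff_tendsto: "(prime_harm_diff \<longlongrightarrow> mertens_const - euler_mascheroni) at_top"
proof -
  have lim1: "filterlim (\<lambda>u::real. nat \<lfloor>u\<rfloor>) sequentially at_top"
    by (intro filterlim_compose[OF filterlim_nat_sequentially] filterlim_floor_sequentially)
  have lim2: "filterlim (\<lambda>u::real. nat \<lfloor>exp u\<rfloor>) sequentially at_top"
    by (rule filterlim_compose[OF lim1 exp_at_top])
  have "((\<lambda>u. mertens_diff (nat \<lfloor>exp u\<rfloor>) + (ln (ln (real (nat \<lfloor>exp u\<rfloor>))) - ln u)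
        - ((harm (nat \<lfloor>u\<rfloor>) - ln (real (nat \<lfloor>u\<rfloor>))) + (ln (real (nat \<lfloor>u\<rfloor>)) - ln u)))
      \<longlongrightarrow> mertens_const + 0 - (euler_mascheroni + 0)) at_top"
  proof (rule tendsto_diff[OF tendsto_add tendsto_add])
    show "((\<lambda>u::real. mertens_diff (nat \<lfloor>exp u\<rfloor>)) \<longlongrightarrow> mertens_const) at_top"
      by (rule filterlim_compose[OF mertens_diff_LIMSEQ lim2])
    show "((\<lambda>u::real. harm (nat \<lfloor>u\<rfloor>) - ln (real (nat \<lfloor>u\<rfloor>))) \<longlongrightarrow> (euler_mascheroni :: real)) at_top"
      by (rule filterlim_compose[OF euler_mascheroni_LIMSEQ lim1])
    show "((\<lambda>u. ln (ln (real (nat \<lfloor>exp u\<rfloor>))) - ln u) \<longlongrightarrow> 0) at_top" by real_asymp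
    show "((\<lambda>u. ln (real (nat \<lfloor>u\<rfloor>)) - ln u) \<longlongrightarrow> 0) at_top" by real_asymp
  qed
  then show ?thesis
    by (simp add: mertens_diff_def prime_harm_diff_def[abs_def] algebra_simps)
qed

lemma prime_recip_sum_mono: "m \<le> n \<Longrightarrow> prime_recip_sum m \<le> prime_recip_sum n"
  unfolding prime_recip_sum_def by (intro sum_mono2) auto

lemma prime_harm_diff_bounded: "\<exists>M. \<forall>u. \<bar>prime_harm_diff u\<bar> \<le> M"
proof -
  define L where "L = mertens_const - euler_mascheroni"
  have "eventually (\<lambda>u. dist (prime_harm_diff u) L < 1) at_top"
    using prime_harm_diff_tendsto unfolding L_def by (rule tendstoD) simp
  then obtain U where U: "\<And>u. u \<ge> U \<Longrightarrow> \<bar>prime_harm_diff u - L\<bar> < 1"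
    unfolding eventually_at_top_linorder dist_real_def by blast
  define M where "M = prime_recip_sum (nat \<lfloor>exp U\<rfloor>) + harm (nat \<lfloor>U\<rfloor>)"
  have "\<bar>prime_harm_diff u\<bar> \<le> max M (\<bar>L\<bar> + 1)" for u
  proof (cases "u \<ge> U")
    case True
    then show ?thesis using U[of u] by linarith
  next
    case False
    then have "prime_recip_sum (nat \<lfloor>exp u\<rfloor>) \<le> prime_recip_sum (nat \<lfloor>exp U\<rfloor>)"
      by (intro prime_recip_sum_mono nat_mono floor_mono) auto
    moreover have "harm (nat \<lfloor>u\<rfloor>) \<le> (harm (nat \<lfloor>U\<rfloor>) :: real)"
      using False by (intro harm_mono nat_mono floor_mono) auto
    moreover have "0 \<le> prime_recip_sum k" for k unfolding prime_recip_sum_def by (intro sum_nonneg) auto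
    moreover have "0 \<le> (harm k :: real)" for k by (rule harm_nonneg)
    ultimately have "\<bar>prime_harm_diff u\<bar> \<le> M"
      unfolding M_def prime_harm_diff_def by (smt (verit))
    then show ?thesis by linarith
  qed
  then show ?thesis by blast
qed

lemma prime_harm_diff_nonpos: "u \<le> 0 \<Longrightarrow> prime_harm_diff u = 0"
proof -
  assume u: "u \<le> 0"
  then have "exp u \<le> 1" by simp
  then have "exp u < 2" by linarith
  then have "nat \<lfloor>exp u\<rfloor> \<le> 1" and u0: "nat \<lfloor>u\<rfloor> = 0"
    using u by (auto simp: nat_le_iff floor_le_iff)
  then have "\<not> (prime p \<and> p \<le> nat \<lfloor>exp u\<rfloor>)" for p
    using prime_gt_1_nat[of p] by linarith
  then have "prime_recip_sum (nat \<lfloor>exp u\<rfloor>) = 0"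
    unfolding prime_recip_sum_def by (intro sum.neutral) blast
  then show ?thesis by (simp add: prime_harm_diff_def u0 harm_def)
qed

text \<open>Abel's theorem at \<open>s = 1 / (n + 1)\<close>: by the two Laplace transforms the left side is
  \<open>\<integral>v. exp (- v) * prime_harm_diff (v / s)\<close>, and the integrand converges boundedly on \<open>v > 0\<close>
  to \<open>exp (- v)\<close> times the limit of \<open>prime_harm_diff\<close>.\<close>
lemma prime_zeta_abel_limit:
  assumes P: "\<And>n. (\<lambda>j. if prime j then real j powr - (1 + 1 / real (Suc n)) else 0) sums P n"
  shows "(\<lambda>n. P n + ln (1 - exp (- (1 / real (Suc n))))) \<longlonglongrightarrow> mertens_const - euler_mascheroni"
proof -
  define L where "L = mertens_const - euler_mascheroni"
  define f where "f = (\<lambda>n v. exp (- v) * prime_harm_diff (v * real (Suc n)))"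
  define g where "g = (\<lambda>v::real. L * (exp (- v) * indicator {0..} v))"
  have f: "has_bochner_integral lborel (f n) (P n + ln (1 - exp (- (1 / real (Suc n)))))" for n
    using has_bochner_integral_diff[OF
        has_bochner_integral_prime_recip_sum[OF _ P[of n]] has_bochner_integral_harm[of "1 / real (Suc n)"]]
    by (simp add: f_def prime_harm_diff_def right_diff_distrib del: of_nat_Suc)
  have g: "has_bochner_integral lborel g (L * exp (- 0))"
    unfolding g_def by (intro has_bochner_integral_mult_right has_bochner_integral_exp_minus_atLeast)
  have meas: "f n \<in> borel_measurable lborel" "g \<in> borel_measurable lborel" for n
    using f[of n] g by (auto simp only: has_bochner_integral_iff intro: borel_measurable_integrable)
  obtain M where M: "\<And>u. \<bar>prime_harm_diff u\<bar> \<le> M" using prime_harm_diff_bounded by blast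
  have "(\<lambda>n. integral\<^sup>L lborel (f n)) \<longlonglongrightarrow> integral\<^sup>L lborel g"
  proof (rule integral_dominated_convergence[where w = "\<lambda>v. M * (exp (- v) * indicator {0..} v)"])
    show "integrable lborel (\<lambda>v::real. M * (exp (- v) * indicator {0..} v))"
      using has_bochner_integral_exp_minus_atLeast[of 0]
      by (intro integrable_mult_right) (auto simp: has_bochner_integral_iff)
    show "AE v in lborel. (\<lambda>n. f n v) \<longlonglongrightarrow> g v"
      using AE_lborel_singleton[of 0]
    proof eventually_elim
      case (elim v)
      show ?case
      proof (cases "v > 0")
        case True
        then have "filterlim (\<lambda>n. v * real (Suc n)) at_top sequentially" by real_asymp
        from filterlim_compose[OF prime_harm_diff_tendsto this]
        have "(\<lambda>n. prime_harm_diff (v * real (Suc n))) \<longlonglongrightarrow> L" by (simp add: L_def)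
        from tendsto_mult[OF tendsto_const[of "exp (- v)"] this] show ?thesis
          using True by (simp add: f_def g_def mult.commute)
      next
        case False
        then have "f n v = 0" for n
          using prime_harm_diff_nonpos[of "v * real (Suc n)"] by (simp add: f_def mult_nonpos_nonneg)
        moreover have "g v = 0" using False elim by (simp add: g_def)
        ultimately show ?thesis by simp
      qed
    qed
    show "AE v in lborel. norm (f n v) \<le> M * (exp (- v) * indicator {0..} v)" for n
    proof (rule AE_I2)
      fix v :: real
      show "norm (f n v) \<le> M * (exp (- v) * indicator {0..} v)"
      proof (cases "v \<ge> 0")
        case True
        then show ?thesis
          using M[of "v * real (Suc n)"] by (simp add: f_def abs_mult mult.commute)
      next
        case False
        then show ?thesis
          using prime_harm_diff_nonpos[of "v * real (Suc n)"] by (simp add: f_def mult_nonpos_nonneg)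
      qed
    qed
  qed (fact meas)+
  then show ?thesis
    using f g by (simp add: has_bochner_integral_iff L_def)
qed

text \<open>By the mean value theorem, \<open>d\<close> is the value of \<open>z powr - (1 + s)\<close> at an intermediate point.\<close>
lemma powr_minus_telescope_bounds:
  fixes s :: real
  assumes "s > 0" "n > 0"
  defines "d \<equiv> real n powr - s / s - real (Suc n) powr - s / s"
  shows "real (Suc n) powr - (1 + s) \<le> d" and "d \<le> real n powr - (1 + s)"
proof -
  have "\<exists>z>real n. z < real (Suc n) \<and> real (Suc n) powr - s / s - real n powr - s / s
      = (real (Suc n) - real n) * (- (z powr - (1 + s)))"
  proof (rule MVT2)
    fix z assume "real n \<le> z" "z \<le> real (Suc n)"
    then have "z > 0" using assms by linarith
    then show "((\<lambda>z. z powr - s / s) has_real_derivative - (z powr - (1 + s))) (at z)"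
      using assms by (auto intro!: derivative_eq_intros simp: powr_diff powr_minus powr_add field_simps)
  qed simp
  then obtain z where z: "real n < z" "z < real (Suc n)" "d = z powr - (1 + s)"
    by (auto simp: d_def)
  show "real (Suc n) powr - (1 + s) \<le> d" "d \<le> real n powr - (1 + s)"
    unfolding z(3) using z assms by (auto intro!: powr_mono2')
qed

lemma riemann_zeta_pole_bounds:
  assumes "s > 0"
  shows "1 / s \<le> riemann_zeta (1 + s)" and "riemann_zeta (1 + s) \<le> 1 + 1 / s"
proof -
  let ?d = "\<lambda>n. real (n + 1) powr - s / s - real (Suc (n + 1)) powr - s / s"
  have "(\<lambda>n. real (n + 1) powr - s / s) \<longlonglongrightarrow> 0"
    using assms by real_asymp
  from telescope_sums'[OF this] have d: "?d sums (1 / s)" by simp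
  have z: "(\<lambda>n. real (n + 1) powr - (1 + s)) sums riemann_zeta (1 + s)"
    using has_sum_riemann_zeta[of "1 + s"] assms unfolding has_sum_nat_shift by (auto dest: has_sum_imp_sums)
  then have z': "(\<lambda>n. real (Suc (n + 1)) powr - (1 + s)) sums (riemann_zeta (1 + s) - 1)"
    using sums_Suc_iff[of "\<lambda>n. real (n + 1) powr - (1 + s)" "riemann_zeta (1 + s) - 1"] by simp
  show "1 / s \<le> riemann_zeta (1 + s)"
  proof (rule sums_le[OF _ d z])
    show "?d n \<le> real (n + 1) powr - (1 + s)" for n
      by (rule powr_minus_telescope_bounds(2)[OF assms]) simp
  qed
  have "riemann_zeta (1 + s) - 1 \<le> 1 / s"
  proof (rule sums_le[OF _ z' d])
    show "real (Suc (n + 1)) powr - (1 + s) \<le> ?d n" for n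
      by (rule powr_minus_telescope_bounds(1)[OF assms]) simp
  qed
  then show "riemann_zeta (1 + s) \<le> 1 + 1 / s" by simp
qed

text \<open>With \<open>s = 1 / (n + 1)\<close>, both \<open>s * \<zeta> (1 + s)\<close> and \<open>(1 - exp (- s)) / s\<close> tend to 1.\<close>
lemma ln_riemann_zeta_pole:
  "(\<lambda>n. ln (riemann_zeta (1 + 1 / real (Suc n))) + ln (1 - exp (- (1 / real (Suc n))))) \<longlonglongrightarrow> 0"
proof -
  define z where "z = (\<lambda>n. riemann_zeta (1 + 1 / real (Suc n)) / real (Suc n))"
  define e where "e = (\<lambda>n. (1 - exp (- (1 / real (Suc n)))) * real (Suc n))"
  have z: "1 \<le> z n" "z n \<le> 1 + 1 / real (Suc n)" for n
  proof -
    define N where "N = real (Suc n)"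
    have N: "N > 0" by (simp add: N_def)
    have "N \<le> riemann_zeta (1 + 1 / N)" "riemann_zeta (1 + 1 / N) \<le> 1 + N"
      using riemann_zeta_pole_bounds[of "1 / N"] N by simp_all
    then have "N / N \<le> z n" "z n \<le> (1 + N) / N"
      using N unfolding z_def N_def[symmetric] by (auto intro: divide_right_mono)
    then show "1 \<le> z n" "z n \<le> 1 + 1 / real (Suc n)"
      using N unfolding N_def[symmetric] by (auto simp: add_divide_distrib)
  qed
  have "(\<lambda>n. 1 + 1 / real (Suc n)) \<longlonglongrightarrow> 1" by real_asymp
  then have "z \<longlonglongrightarrow> 1"
    using z by (intro tendsto_sandwich[of "\<lambda>_. 1" z sequentially "\<lambda>n. 1 + 1 / real (Suc n)"]) auto
  moreover have "e \<longlonglongrightarrow> 1" unfolding e_def by real_asymp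
  ultimately have "(\<lambda>n. ln (z n) + ln (e n)) \<longlonglongrightarrow> ln 1 + ln 1" by (intro tendsto_intros) auto
  moreover have "ln (z n) + ln (e n) = ln (riemann_zeta (1 + 1 / real (Suc n))) + ln (1 - exp (- (1 / real (Suc n))))" for n
  proof -
    have "1 - exp (- (1 / real (Suc n))) > 0" by simp
    moreover have "riemann_zeta (1 + 1 / real (Suc n)) > 0" using z(1)[of n]
      by (simp add: z_def field_simps)
    ultimately show ?thesis by (simp add: z_def e_def ln_mult ln_div del: of_nat_Suc)
  qed
  ultimately show ?thesis by simp
qed

text \<open>By the Euler product the difference is a sum over primes of \<open>- ln (1 - y) - y\<close> with
  \<open>y = p powr - (1 + s)\<close>, which is at most \<open>2 / p\<^sup>2\<close> for every \<open>s > 0\<close>. Tannery's theorem therefore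
  allows \<open>s \<longrightarrow> 0\<close> in each term.\<close>
lemma ln_zeta_minus_prime_zeta_limit:
  assumes P: "\<And>n. (\<lambda>j. if prime j then real j powr - (1 + 1 / real (Suc n)) else 0) sums P n"
  shows "(\<lambda>n. ln (riemann_zeta (1 + 1 / real (Suc n))) - P n) \<longlonglongrightarrow> - prime_log_sum"
proof -
  define h where "h = (\<lambda>y::real. - ln (1 - y) - y)"
  define a where "a = (\<lambda>j n. if prime j then h (real j powr - (1 + 1 / real (Suc n))) else 0)"
  define b where "b = (\<lambda>j::nat. if prime j then h (1 / real j) else 0)"
  have h: "0 \<le> h y" "h y \<le> 2 * y\<^sup>2" if "0 \<le> y" "y \<le> 1 / 2" for y
    using minus_ln_one_minus_bounds[OF that] by (auto simp: h_def)
  have half: "0 < 1 / real p" "1 / real p \<le> 1 / 2" if "prime p" for p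
    using prime_ge_2_nat[OF that] by auto
  have T: "(\<lambda>n. suminf (\<lambda>j. a j n)) \<longlonglongrightarrow> suminf b"
  proof (rule tannerys_theorem[THEN conjunct2, THEN conjunct2])
    show "(\<lambda>n. a j n) \<longlonglongrightarrow> b j" for j
    proof (cases "prime j")
      case True
      have "(\<lambda>n. - (1 + 1 / real (Suc n))) \<longlonglongrightarrow> - 1" by real_asymp
      then have "(\<lambda>n. real j powr - (1 + 1 / real (Suc n))) \<longlonglongrightarrow> real j powr - 1"
        using True prime_gt_0_nat by (intro tendsto_powr tendsto_const) auto
      moreover have "real j powr - 1 = 1 / real j" using prime_gt_0_nat[OF True] by (simp add: powr_minus_divide)
      ultimately show ?thesis
        unfolding a_def b_def h_def using True half[OF True] by (auto intro!: tendsto_intros)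
    qed (auto simp: a_def b_def)
    show "summable (\<lambda>j. 2 * real j powr - 2)"
      by (intro summable_mult) (auto simp: summable_real_powr_iff)
    have "norm (a j n) \<le> 2 * real j powr - 2" for j n
    proof (cases "prime j")
      case True
      define y where "y = real j powr - (1 + 1 / real (Suc n))"
      have "y \<le> real j powr - 1"
        unfolding y_def using prime_gt_1_nat[OF True] by (intro powr_mono) auto
      also have "\<dots> = 1 / real j" using prime_gt_0_nat[OF True] by (simp add: powr_minus_divide)
      finally have y: "y \<le> 1 / real j" "y \<le> 1 / 2" "y \<ge> 0"
        using half[OF True] by (linarith, linarith, simp add: y_def)
      have "norm (a j n) \<le> 2 * y\<^sup>2" using h[of y] y True by (simp add: a_def y_def)
      also have "\<dots> \<le> 2 * (1 / real j)\<^sup>2" using y by (intro mult_left_mono power_mono) auto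
      also have "(1 / real j)\<^sup>2 = real j powr - 2"
        using prime_gt_0_nat[OF True] by (simp add: powr_minus_divide power_divide)
      finally show ?thesis .
    qed (auto simp: a_def)
    then show "\<forall>\<^sub>F (j, n) in at_top \<times>\<^sub>F sequentially. norm (a j n) \<le> 2 * real j powr - 2"
      by (intro always_eventually) auto
  qed auto
  have "suminf (\<lambda>j. a j n) = ln (riemann_zeta (1 + 1 / real (Suc n))) - P n" for n
  proof -
    let ?s = "1 + 1 / real (Suc n)"
    have "((\<lambda>p. - ln (1 - real p powr - ?s)) has_sum ln (riemann_zeta ?s)) {p. prime p}"
      by (intro ln_riemann_zeta_euler_product) simp
    moreover have "0 \<le> - ln (1 - real p powr - ?s)" if "prime p" for p
    proof -
      have "?s > 0" by (intro add_pos_nonneg) auto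
      from prime_powr_minus_bounds[OF that this] show ?thesis
        using ln_le_zero_iff[of "1 - real p powr - ?s"] by linarith
    qed
    ultimately have "(\<lambda>j. if prime j then - ln (1 - real j powr - ?s) else 0) sums ln (riemann_zeta ?s)"
      by (simp only: has_sum_primes_iff_sums)
    from sums_diff[OF this P[of n]] have "(\<lambda>j. a j n) sums (ln (riemann_zeta ?s) - P n)"
      by (rule sums_cong[THEN iffD1, rotated]) (auto simp: a_def h_def)
    then show ?thesis by (rule sums_unique[symmetric])
  qed
  moreover have "suminf b = - prime_log_sum"
  proof -
    have bn: "0 \<le> h (1 / real p)" "h (1 / real p) \<le> 2 * (1 / real p)\<^sup>2" if "prime p" for p
      using h[of "1 / real p"] half[OF that] by auto
    have "(\<lambda>p. h (1 / real p)) summable_on {p. prime p}"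
      by (rule summable_on_comparison_test[OF summable_on_primes_inverse_square[of 2]]) (use bn in auto)
    then obtain S where S: "((\<lambda>p. h (1 / real p)) has_sum S) {p. prime p}" by (auto simp: summable_on_def)
    then have "b sums S" unfolding b_def using bn by (subst (asm) has_sum_primes_iff_sums) auto
    moreover have "((\<lambda>p. 1 / real p + ln (1 - 1 / real p)) has_sum - S) {p. prime p}"
      using has_sum_uminusI[OF S] by (simp add: h_def algebra_simps)
    ultimately show ?thesis unfolding prime_log_sum_def by (simp add: infsumI sums_unique[symmetric])
  qed
  ultimately show ?thesis using T by simp
qed

theorem mertens_const_eq: "mertens_const = euler_mascheroni + prime_log_sum"
proof -
  define P where "P = (\<lambda>n. \<Sum>j. if prime j then real j powr - (1 + 1 / real (Suc n)) else 0)"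
  have P: "(\<lambda>j. if prime j then real j powr - (1 + 1 / real (Suc n)) else 0) sums P n" for n
    unfolding P_def
  proof (rule summable_sums, rule summable_comparison_test')
    show "summable (\<lambda>j. real j powr - (1 + 1 / real (Suc n)))"
      by (auto simp: summable_real_powr_iff)
  qed auto
  have "(\<lambda>n. (ln (riemann_zeta (1 + 1 / real (Suc n))) + ln (1 - exp (- (1 / real (Suc n)))))
      - (ln (riemann_zeta (1 + 1 / real (Suc n))) - P n)) \<longlonglongrightarrow> 0 - (- prime_log_sum)"
    by (intro tendsto_diff ln_riemann_zeta_pole ln_zeta_minus_prime_zeta_limit P)
  then have "(\<lambda>n. P n + ln (1 - exp (- (1 / real (Suc n))))) \<longlonglongrightarrow> prime_log_sum"
    by (simp add: algebra_simps)
  with prime_zeta_abel_limit[OF P] have "mertens_const - euler_mascheroni = prime_log_sum"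
    by (rule LIMSEQ_unique)
  then show ?thesis by simp
qed

section \<open>The error bound\<close>

text \<open>As \<open>1 + 2 * ln 4 < 3.78\<close>, there is room to spare for large \<open>n\<close>; the inequality is tight only at
  \<open>n = 3\<close>, where \<open>4 ^ 7 < 3 ^ 9\<close> is just sufficient.\<close>
lemma mertens_error_bound_large:
  assumes "n \<ge> 3"
  shows "(1 + 2 * ln 4) / ln (real n) < 4 / ln (real n + 1) + 2 / (real n * ln (real n))"
proof -
  have n: "real n \<ge> 3" using assms by simp
  have ln0: "ln (real n) > 0" "ln (real n + 1) > 0" using n by auto
  have l2: "ln 2 \<le> (25 / 36 :: real)" by (rule ln2_le_25_over_36)
  \<comment> \<open>The claim multiplied by \<open>ln n\<close>.\<close>
  have "1 + 2 * ln 4 < 4 * (ln (real n) / ln (real n + 1)) + 2 / real n"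
  proof (cases "n = 3")
    case True
    have "7 * ln 4 = ln (4 ^ 7 :: real)" by (subst ln_realpow) auto
    also have "\<dots> < ln (3 ^ 9)" by (subst ln_less_cancel_iff) auto
    also have "\<dots> = 9 * ln (3::real)" by (subst ln_realpow) auto
    finally have "ln (3::real) / ln 4 > 7 / 9" by (simp add: field_simps)
    then show ?thesis using l2 ln_4_eq True by simp
  next
    case False
    then have n4: "real n \<ge> 4" using assms by simp
    have "9 * ln 2 = ln (2 ^ 9 :: real)" by (subst ln_realpow) auto
    also have "\<dots> \<le> ln (5 ^ 4)" by (subst ln_le_cancel_iff) auto
    also have "\<dots> = 4 * ln (5::real)" by (subst ln_realpow) auto
    finally have "ln (5::real) \<ge> 3 / 2" using ln2_ge_two_thirds by simp
    also have "ln 5 \<le> ln (real n + 1)" using n4 by (subst ln_le_cancel_iff) auto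
    finally have l: "ln (real n + 1) \<ge> 3 / 2" .
    have "ln (real n + 1) - ln (real n) \<le> 1 / real n"
      using ln_Suc_minus_ln_le[of n] n by (simp add: add.commute)
    then have "(ln (real n + 1) - ln (real n)) / ln (real n + 1) \<le> (1 / real n) / (3 / 2)"
      using n ln0 l by (intro frac_le) auto
    then have "ln (real n) / ln (real n + 1) \<ge> 1 - 2 / (3 * real n)"
      using ln0 by (simp add: diff_divide_distrib)
    moreover have "2 / (3 * real n) = 2 / 3 * (1 / real n)" "2 / real n = 2 * (1 / real n)" "1 / real n \<le> 1 / 4"
      using n4 by (auto simp: field_simps)
    ultimately have "4 * (ln (real n) / ln (real n + 1)) + 2 / real n \<ge> 4 - 1 / 6" by linarith
    then show ?thesis using l2 ln_4_eq by linarith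
  qed
  from divide_strict_right_mono[OF this ln0(1)]
  show ?thesis using ln0 by (simp add: add_divide_distrib)
qed

text \<open>At \<open>n = 2\<close> the uniform bound \<open>(1 + 2 * ln 4) / ln n\<close> is too large, but there the value
  \<open>mertens_err 2 = - ln 2 / 2\<close> lies well inside the interval allowed by Mertens' first theorem.\<close>
theorem mertens_diff_error:
  assumes "n \<ge> 2"
  shows "\<bar>mertens_diff n - mertens_const\<bar> < 4 / ln (real n + 1) + 2 / (real n * ln (real n))"
proof (cases "n = 2")
  case True
  have "{p::nat. prime p \<and> p \<le> 2} = {2}"
    using prime_ge_2_nat two_is_prime_nat le_antisym by blast
  then have E: "mertens_err 2 = - ln 2 / 2" by (simp add: mertens_err_def)
  have l2: "ln (2::real) > 0" by simp
  have "ln (3::real) \<le> ln 4" by simp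
  then have "ln (3::real) \<le> 3 / 2" using ln2_le_25_over_36 ln_4_eq by linarith
  then have l3: "4 / ln (3::real) \<ge> 8 / 3" by (simp add: field_simps)
  have "mertens_diff 2 - mertens_const \<le> (1 + 3 / 2 * ln 2) / ln 2"
    using mertens_diff_minus_const(1)[of 2] by (simp add: E ln_4_eq algebra_simps)
  also have "\<dots> = 1 / ln 2 + 3 / 2" using l2 by (simp add: field_simps)
  finally have "mertens_diff 2 - mertens_const \<le> 1 / ln 2 + 3 / 2" .
  moreover have "mertens_diff 2 - mertens_const \<ge> - 5 / 2"
    using mertens_diff_minus_const(2)[of 2] l2 by (simp add: E ln_4_eq field_simps)
  moreover have "1 / ln (2::real) > 0" by simp
  moreover have "4 / ln (real n + 1) + 2 / (real n * ln (real n)) = 4 / ln 3 + 1 / ln 2"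
    by (simp add: True)
  ultimately show ?thesis using l3 unfolding True by linarith
next
  case False
  then have n: "n \<ge> 3" using assms by simp
  have ln0: "ln (real n) > 0" using n by simp
  have "1 / real n \<ge> 0" by simp
  then have "mertens_err n + 1 + ln 4 \<le> 1 + 2 * ln 4" "mertens_err n - ln 4 \<ge> - (1 + 2 * ln 4)"
    using mertens_err_upper[of n] mertens_err_lower[of n] n by linarith+
  from this[THEN divide_right_mono, OF less_imp_le[OF ln0]]
  have "(mertens_err n + 1 + ln 4) / ln (real n) \<le> (1 + 2 * ln 4) / ln (real n)"
    "(mertens_err n - ln 4) / ln (real n) \<ge> - ((1 + 2 * ln 4) / ln (real n))"
    by (simp_all only: minus_divide_left)
  then have "\<bar>mertens_diff n - mertens_const\<bar> \<le> (1 + 2 * ln 4) / ln (real n)"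
    using mertens_diff_minus_const[OF assms] by linarith
  also have "\<dots> < 4 / ln (real n + 1) + 2 / (real n * ln (real n))"
    by (rule mertens_error_bound_large[OF n])
  finally show ?thesis .
qed

theorem theorem2:
  fixes x \<delta> :: real
  assumes "x \<ge> 2"
    and "(\<Sum>p | prime p \<and> real p \<le> x. 1 / real p) =
           ln (ln (real_of_int \<lfloor>x\<rfloor>)) + euler_mascheroni
           + (\<Sum>k. real_of_int (moebius_mu (k + 2)) * ln (riemann_zeta (real (k + 2))) / real (k + 2))
           + \<delta>"
  shows "\<bar>\<delta>\<bar> < 4 / ln (real_of_int \<lfloor>x\<rfloor> + 1)
           + 2 / (real_of_int \<lfloor>x\<rfloor> * ln (real_of_int \<lfloor>x\<rfloor>))"
proof -
  define n where "n = nat \<lfloor>x\<rfloor>"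
  have n: "real_of_int \<lfloor>x\<rfloor> = real n" "n \<ge> 2"
    using assms(1) by (auto simp: n_def le_nat_iff le_floor_iff)
  have "{p. prime p \<and> real p \<le> x} = {p. prime p \<and> p \<le> n}"
    using assms(1) by (auto simp: n_def le_nat_iff le_floor_iff)
  then have "prime_recip_sum n = ln (ln (real n)) + euler_mascheroni + prime_log_sum + \<delta>"
    using assms(2) sums_unique[OF sums_moebius_ln_riemann_zeta] by (simp only: prime_recip_sum_def n)
  then have "\<delta> = mertens_diff n - mertens_const"
    by (simp add: mertens_diff_def mertens_const_eq)
  then show ?thesis unfolding n(1) using mertens_diff_error[OF n(2)] by (simp only:)
qed

end
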